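(* (Identifiability under Poisson design.) Consider Poisson eviction of a cache $\mathcal{C}$ with certainty set $\mathcal{A}$, tail $\mathcal{T} = \mathcal{C}\setminus\mathcal{A}$, inclusion probabilities $\pi_i$, expected tail budget $m$, floor $\varepsilon > 0$ and retained set $\mathcal{S}$, as described in the context. Write $N = \sum_{i \in \mathcal{C}} a_i$ and let $$e_t^{\mathrm{lin}} = \frac{1}{N}\sum_{i \in \mathcal{T}} \Big(\frac{I_i}{\pi_i} - 1\Big)\, a_i (v_i - y_t)$$ denote the first-order (linearized) error of the Hájek estimator $$\hat{y}_t = \frac{\sum_{i \in \mathcal{S}} (a_i/\pi_i)\, v_i}{\sum_{i \in \mathcal{S}} a_i/\pi_i},$$ where $I_i$ is the retention indicator of token $i$. Assume: (Known design) The probabilities $\pi_i$ are chosen by the algorithm, stored, and bounded below by $\varepsilon$ on the tail. (Bounded weights) Normalized weights are bounded: $a_i/(\pi_i \sum_{j\in\mathcal{C}} a_j) \le B/m$ for all $i \in \mathcal{T}$. Then $$\widehat{V}_t = \frac{1}{\widehat{N}^2} \sum_{i \in \mathcal{S} \cap \mathcal{T}} \frac{1 - \pi_i}{\pi_i^2}\, a_i^2\, \|v_i - \hat{y}_t\|^2, \qquad \widehat{N} = \sum_{i \in \mathcal{S}} a_i/\pi_i,$$ satisfies $\mathbb{E}[\widehat{V}_t] = \mathrm{Var}(e_t^{\mathrm{lin}}) + O(B^2/m^2)$, and $\widehat{V}_t$ is computable from the retained set alone. Under Poisson sampling the Sen--Yates--Grundy double sum collapses to the single sum above, so the cost is $O(|\mathcal{S}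 \cap \mathcal{T}|)$ per head per step.
   Context: Fix one attention head at decode step $t$. The cache is $\mathcal{C} = \{(k_i, v_i)\}_{i=1}^{n}$, consisting of keys $k_i$ and values $v_i$ (write $i\in\mathcal{C}$ for $i\in\{1,\dots,n\}$); the query is $q_t$; the scores are $s_i = q_t^\top k_i/\sqrt{d}$, where $d$ is the dimension of the keys and query; the weights are $a_i = e^{s_i}$; and the full-cache head output is $y_t = \big(\sum_{i\in\mathcal{C}} a_i v_i\big)/\big(\sum_{i\in\mathcal{C}} a_i\big)$. Design: the mechanism keeps a certainty set $\mathcal{A}\subseteq\mathcal{C}$ (the top slice of an importance score together with attention-sink positions and a recency window) with $\pi_i = 1$ for $i \in \mathcal{A}$, and applies to the tail $\mathcal{T} = \mathcal{C}\setminus\mathcal{A}$ independent Bernoulli retention (Poisson sampling) with inclusion probabilities $$\pi_i = \mathrm{clip}\Big(m\cdot\frac{\mathrm{score}_i}{\sum_{j\in\mathcal{T}}\mathrm{score}_j},\ \varepsilon,\ 1\Big),\qquad i\in\mathcal{T},$$ where $\mathrm{score}_i$ is the importance score of token $i$, $m$ is the expected tail budget, $\varepsilon>0$ is a floor, and $\mathrm{clip}(x,\varepsilon,1)=\min(\max(x,\varepsilon),1)$. The indicator $I_i$ equals $1$ if token $i$ is retained and $0$ otherwise; the retained set $\mathcal{S}$ consists of $\mathcal{A}$ and the tail tokens with $I_i=1$; all other tokens are deleted permanently. The bounded-weights condition is described as guaranteed constructively by the floor $\varepsilon$ and by the certainty set, which absorbs the head of the score distribution. Expectation and variance are taken conditionally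 on the query and the cache contents, so that the only randomness is in the indicators $I_i$, $i\in\mathcal{T}$, with known $\pi_i$; the variance of the vector $e_t^{\mathrm{lin}}$ is the scalar $\mathbb{E}\|e_t^{\mathrm{lin}} - \mathbb{E}e_t^{\mathrm{lin}}\|^2$. The Sen--Yates--Grundy double sum refers to the classical survey-sampling variance form, a double sum over pairs of units involving the joint inclusion probabilities $\pi_{ij}$ (the probability that tokens $i$ and $j$ are both retained); under Poisson sampling these factor as $\pi_{ij}=\pi_i\pi_j$ for $i\neq j$.
   Formalization: The double sum is taken in product (Horvitz–Thompson) form, since the Sen–Yates–Grundy squared-difference form is 0 under Poisson sampling; the O(B²/m²) constant carries the factor max‖v_i‖²; the cost counts arithmetic operations with N̂ and ŷ_t given. *)

theory Defs
  imports "HOL-Analysis.Analysis" "HOL-Probability.Probability" "HOL-Probability.Product_PMF"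
begin

section \<open>Poisson eviction of a key-value cache\<close>

text \<open>Tokens are the indices \<open>1, \<dots>, cache_size\<close>. The certainty set is an arbitrary set of tokens,
  so every way of forming it (top scores, attention sinks, recency window) is covered.\<close>

record ('d::finite, 'p::finite) eviction =
  cache_size :: nat
  query :: "real^'d"
  key :: "nat \<Rightarrow> real^'d"
  val :: "nat \<Rightarrow> real^'p"
  cert :: "nat set"
  score :: "nat \<Rightarrow> real"
  budget :: real
  floor_prob :: real

definition cache :: "('d::finite, 'p::finite) eviction \<Rightarrow> nat set" where
  "cache X = {1..cache_size X}"

definition poisson_eviction :: "('d::finite, 'p::finite) eviction \<Rightarrow> bool" where
  "poisson_eviction X \<longleftrightarrow>
     1 \<le> cache_size X \<and> cert X \<subseteq> cache X \<and> 0 < budget X \<and> 0 < floor_prob X"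

definition tail :: "('d::finite, 'p::finite) eviction \<Rightarrow> nat set" where
  "tail X = cache X - cert X"

definition attn_score :: "('d::finite, 'p::finite) eviction \<Rightarrow> nat \<Rightarrow> real" where
  "attn_score X i = (query X \<bullet> key X i) / sqrt (real CARD('d))"

definition weight :: "('d::finite, 'p::finite) eviction \<Rightarrow> nat \<Rightarrow> real" where
  "weight X i = exp (attn_score X i)"

definition total_weight :: "('d::finite, 'p::finite) eviction \<Rightarrow> real" where
  "total_weight X = (\<Sum>i\<in>cache X. weight X i)"

definition head_output :: "('d::finite, 'p::finite) eviction \<Rightarrow> real^'p" where
  "head_output X = (1 / total_weight X) *\<^sub>R (\<Sum>i\<in>cache X. weight X i *\<^sub>R val X i)"

definition clip :: "real \<Rightarrow> real \<Rightarrow> real \<Rightarrow> real" where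
  "clip x lo hi = min (max x lo) hi"

text \<open>If all tail scores vanish, the quotient is \<open>0\<close> by the convention \<open>x / 0 = 0\<close> and the
  inclusion probability is the (clipped) floor.\<close>

definition incl_prob :: "('d::finite, 'p::finite) eviction \<Rightarrow> nat \<Rightarrow> real" where
  "incl_prob X i =
     (if i \<in> cert X then 1
      else clip (budget X * (score X i / (\<Sum>j\<in>tail X. score X j))) (floor_prob X) 1)"

text \<open>The distribution of the retention indicators of the tail tokens, i.e. the only source of
  randomness. Coordinates outside the tail are constantly \<open>False\<close> and never used.\<close>

definition poisson_design :: "('d::finite, 'p::finite) eviction \<Rightarrow> (nat \<Rightarrow> bool) pmf" where
  "poisson_design X = Pi_pmf (tail X) False (\<lambda>i. bernoulli_pmf (incl_prob X i))"

definition retained :: "('d::finite, 'p::finite) eviction \<Rightarrow> (nat \<Rightarrow> bool) \<Rightarrow> nat set" where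
  "retained X I = cert X \<union> {i \<in> tail X. I i}"

definition joint_incl_prob :: "('d::finite, 'p::finite) eviction \<Rightarrow> nat \<Rightarrow> nat \<Rightarrow> real" where
  "joint_incl_prob X i j =
     measure_pmf.prob (poisson_design X) {I. i \<in> retained X I \<and> j \<in> retained X I}"

section \<open>Assumptions\<close>

definition known_design :: "('d::finite, 'p::finite) eviction \<Rightarrow> bool" where
  "known_design X \<longleftrightarrow> (\<forall>i\<in>tail X. floor_prob X \<le> incl_prob X i)"

definition bounded_weights :: "('d::finite, 'p::finite) eviction \<Rightarrow> real \<Rightarrow> bool" where
  "bounded_weights X B \<longleftrightarrow>
     (\<forall>i\<in>tail X. weight X i / (incl_prob X i * total_weight X) \<le> B / budget X)"

section \<open>Estimators\<close>

text \<open>If nothing is retained (possible only when the certainty set is empty), \<open>total_weight_est\<close>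
  is \<open>0\<close>, and \<open>hajek\<close> and \<open>var_est\<close> are \<open>0\<close> by the convention \<open>x / 0 = 0\<close>.\<close>

definition total_weight_est :: "('d::finite, 'p::finite) eviction \<Rightarrow> (nat \<Rightarrow> bool) \<Rightarrow> real" where
  "total_weight_est X I = (\<Sum>i\<in>retained X I. weight X i / incl_prob X i)"

definition hajek :: "('d::finite, 'p::finite) eviction \<Rightarrow> (nat \<Rightarrow> bool) \<Rightarrow> real^'p" where
  "hajek X I = (1 / total_weight_est X I) *\<^sub>R
     (\<Sum>i\<in>retained X I. (weight X i / incl_prob X i) *\<^sub>R val X i)"

definition lin_error :: "('d::finite, 'p::finite) eviction \<Rightarrow> (nat \<Rightarrow> bool) \<Rightarrow> real^'p" where
  "lin_error X I = (1 / total_weight X) *\<^sub>R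
     (\<Sum>i\<in>tail X. ((of_bool (I i) / incl_prob X i - 1) * weight X i) *\<^sub>R (val X i - head_output X))"

definition vec_variance :: "'a pmf \<Rightarrow> ('a \<Rightarrow> 'b::euclidean_space) \<Rightarrow> real" where
  "vec_variance p f =
     measure_pmf.expectation p (\<lambda>x. (norm (f x - measure_pmf.expectation p f))\<^sup>2)"

definition var_est :: "('d::finite, 'p::finite) eviction \<Rightarrow> (nat \<Rightarrow> bool) \<Rightarrow> real" where
  "var_est X I = 1 / (total_weight_est X I)\<^sup>2 *
     (\<Sum>i\<in>retained X I \<inter> tail X.
        (1 - incl_prob X i) / (incl_prob X i)\<^sup>2 * (weight X i)\<^sup>2 * (norm (val X i - hajek X I))\<^sup>2)"

text \<open>The design-based variance estimator as a double sum over ordered pairs of retained tail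
  units, diagonal included (with \<open>\<pi>\<^sub>i\<^sub>i = \<pi>\<^sub>i\<close>), applied to the plug-in linearized
  variable \<open>z\<^sub>i = a\<^sub>i (v\<^sub>i - hajek) / total_weight_est\<close>. The product form is used: the
  squared-difference form
  \<open>- 1/2 \<Sum>\<^sub>i\<^sub>j (\<pi>\<^sub>i\<^sub>j - \<pi>\<^sub>i \<pi>\<^sub>j) / \<pi>\<^sub>i\<^sub>j \<cdot> \<parallel>z\<^sub>i / \<pi>\<^sub>i - z\<^sub>j / \<pi>\<^sub>j\<parallel>\<^sup>2\<close>
  agrees with it for designs of fixed size only and is identically \<open>0\<close> for a Poisson design.\<close>

definition var_est_double_sum :: "('d::finite, 'p::finite) eviction \<Rightarrow> (nat \<Rightarrow> bool) \<Rightarrow> real" where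
  "var_est_double_sum X I =
     (let z = (\<lambda>i. (weight X i / total_weight_est X I) *\<^sub>R (val X i - hajek X I)) in
      \<Sum>i\<in>retained X I \<inter> tail X. \<Sum>j\<in>retained X I \<inter> tail X.
        (joint_incl_prob X i j - incl_prob X i * incl_prob X j) / joint_incl_prob X i j *
        ((z i /\<^sub>R incl_prob X i) \<bullet> (z j /\<^sub>R incl_prob X j)))"

definition value_scale :: "('d::finite, 'p::finite) eviction \<Rightarrow> real" where
  "value_scale X = Max ((\<lambda>i. norm (val X i)) ` cache X)"

section \<open>Computability from stored data\<close>

text \<open>Real-arithmetic programs are formulas over named scalar inputs. The cost of a program is the
  number of its arithmetic operations; vectors enter through their coordinates.\<close>

datatype (inputs: 'x) program =
    Input 'x
  | Const real
  | Add "'x program" "'x program"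
  | Sub "'x program" "'x program"
  | Mul "'x program" "'x program"
  | Div "'x program" "'x program"
  | Exp "'x program"

primrec run :: "('x \<Rightarrow> real) \<Rightarrow> 'x program \<Rightarrow> real" where
  "run \<rho> (Input x) = \<rho> x"
| "run \<rho> (Const r) = r"
| "run \<rho> (Add e f) = run \<rho> e + run \<rho> f"
| "run \<rho> (Sub e f) = run \<rho> e - run \<rho> f"
| "run \<rho> (Mul e f) = run \<rho> e * run \<rho> f"
| "run \<rho> (Div e f) = run \<rho> e / run \<rho> f"
| "run \<rho> (Exp e) = exp (run \<rho> e)"

primrec ops :: "'x program \<Rightarrow> nat" where
  "ops (Input x) = 0"
| "ops (Const r) = 0"
| "ops (Add e f) = Suc (ops e + ops f)"
| "ops (Sub e f) = Suc (ops e + ops f)"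
| "ops (Mul e f) = Suc (ops e + ops f)"
| "ops (Div e f) = Suc (ops e + ops f)"
| "ops (Exp e) = Suc (ops e)"

text \<open>\<open>NormHat\<close> and \<open>OutHat\<close> are the normalizer and the coordinates of the output of the attention
  step on the retained set.\<close>

datatype ('d, 'p) datum =
    Query 'd
  | Key nat 'd
  | Val nat 'p
  | Prob nat
  | NormHat
  | OutHat 'p

primrec read_datum ::
  "('d::finite, 'p::finite) eviction \<Rightarrow> (nat \<Rightarrow> bool) \<Rightarrow> ('d, 'p) datum \<Rightarrow> real" where
  "read_datum X I (Query c) = query X $ c"
| "read_datum X I (Key i c) = key X i $ c"
| "read_datum X I (Val i c) = val X i $ c"
| "read_datum X I (Prob i) = incl_prob X i"
| "read_datum X I NormHat = total_weight_est X I"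
| "read_datum X I (OutHat c) = hajek X I $ c"

definition stored_data :: "nat set \<Rightarrow> ('d, 'p) datum set" where
  "stored_data U = range Query \<union>
     (\<Union>i\<in>U. range (Key i) \<union> range (Val i) \<union> {Prob i})"

definition step_output :: "('d, 'p) datum set" where
  "step_output = insert NormHat (range OutHat)"

end

theory Submission
  imports Defs
begin

text \<open>Put \<open>b = B / m\<close>, \<open>V = max \<parallel>v\<^sub>i\<parallel>\<close>, \<open>r\<close> for the estimated divided by the true total weight,
  \<open>e\<close> for the linearized error, \<open>u\<^sub>i = v\<^sub>i - y\<close>, and let \<open>x\<^sub>i = a\<^sub>i / (\<pi>\<^sub>i N) \<le> b\<close> be the relative
  weights. Since \<open>hajek - y = e / r\<close>, the estimator equals
  \<open>q\<^sub>2 / r\<^sup>2 - 2 (q\<^sub>1 \<bullet> e) / r^3 + q\<^sub>0 \<parallel>e\<parallel>\<^sup>2 / r^4\<close>, where the \<open>q\<^sub>k\<close> are the sums of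
  \<open>I\<^sub>i (1 - \<pi>\<^sub>i) x\<^sub>i\<^sup>2\<close> times \<open>1\<close>, \<open>u\<^sub>i\<close>, \<open>\<parallel>u\<^sub>i\<parallel>\<^sup>2\<close>. Its first-order expansion at \<open>r = 1\<close>, \<open>e = 0\<close> is
  \<open>q\<^sub>2 - 2 q\<^sub>2 (r - 1) - 2 (q\<^sub>1 \<bullet> e)\<close>; here \<open>q\<^sub>2\<close> has expectation \<open>Var e\<close>, and the other two terms
  are covariances of sums of independent indicators, of size \<open>V\<^sup>2 b\<^sup>2\<close>. On \<open>r \<ge> 1/2\<close> the remainder
  is at most a multiple of \<open>b (V\<^sup>2 (r - 1)\<^sup>2 + \<parallel>e\<parallel>\<^sup>2)\<close>, again of expected size \<open>V\<^sup>2 b\<^sup>2\<close>.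
  On \<open>r < 1/2\<close> everything is bounded by a multiple of \<open>V\<^sup>2\<close>; Chebyshev would give only
  probability \<open>O(b)\<close>, but the Chernoff bound \<open>exp (- 1 / (8 b))\<close> is \<open>O(b\<^sup>2)\<close>. For \<open>b > 1\<close> the
  crude bounds \<open>4 V\<^sup>2\<close> on the estimator and \<open>4 V\<^sup>2 b\<close> on the variance suffice.\<close>

section \<open>Sums of independent Bernoulli indicators\<close>

text \<open>The event is a product set that fixes two coordinates and leaves the others free, so the
  product law multiplies the two marginals.\<close>

lemma prob_bernoulli_both:
  assumes "finite T" "i \<in> T" "j \<in> T" "i \<noteq> j" "\<And>k. k \<in> T \<Longrightarrow> 0 \<le> p k \<and> p k \<le> 1"
  shows "measure_pmf.prob (Pi_pmf T False (\<lambda>k. bernoulli_pmf (p k))) {I. I i \<and> I j} = p i * p j"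
proof -
  let ?B = "\<lambda>k. if k \<in> {i, j} then {True} else UNIV"
  have "{I. I i \<and> I j} = Pi T ?B"
    using assms by (auto simp: Pi_def split: if_splits)
  then have "measure_pmf.prob (Pi_pmf T False (\<lambda>k. bernoulli_pmf (p k))) {I. I i \<and> I j} =
      (\<Prod>k\<in>T. measure_pmf.prob (bernoulli_pmf (p k)) (?B k))"
    using assms(1) by (simp add: measure_Pi_pmf_Pi)
  also have "\<dots> = (\<Prod>k\<in>{i, j}. p k)"
    using assms by (intro prod.mono_neutral_cong_right) (auto simp: measure_pmf_single)
  finally show ?thesis using assms(4) by simp
qed

lemma prob_bernoulli_component:
  assumes "finite T" "i \<in> T" "0 \<le> p i" "p i \<le> 1"
  shows "measure_pmf.prob (Pi_pmf T False (\<lambda>k. bernoulli_pmf (p k))) {I. I i} = p i"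
proof -
  let ?M = "Pi_pmf T False (\<lambda>k. bernoulli_pmf (p k))"
  have "measure_pmf.prob ?M {I. I i} = measure_pmf.prob (map_pmf (\<lambda>I. I i) ?M) {True}"
    by (simp add: vimage_def)
  also have "\<dots> = p i"
    using assms by (simp add: Pi_pmf_component measure_pmf_single)
  finally show ?thesis .
qed

text \<open>Finite support makes every function of the indicators integrable, which discharges the
  integrability conditions below.\<close>

lemma finite_set_Pi_bernoulli:
  "finite T \<Longrightarrow> finite (set_pmf (Pi_pmf T False (\<lambda>k. bernoulli_pmf (p k))))"
  by (subst set_Pi_pmf) auto

lemma expectation_of_bool:
  "measure_pmf.expectation M (\<lambda>I. of_bool (P I)) = measure_pmf.prob M {I. P I}"
proof -
  have "(\<lambda>I. of_bool (P I) :: real) = indicator {I. P I}"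
    by (auto simp: indicator_def)
  then show ?thesis by simp
qed

text \<open>Expanding the product leaves probabilities of one or two indicators;
  \<open>of_bool (I i \<and> I j)\<close> covers both cases, since it reduces to a single indicator
  when \<open>i = j\<close>.\<close>

lemma covariance_bernoulli:
  assumes fin: "finite T" and p: "\<And>k. k \<in> T \<Longrightarrow> 0 \<le> p k \<and> p k \<le> 1" and i: "i \<in> T" and j: "j \<in> T"
  shows "measure_pmf.expectation (Pi_pmf T False (\<lambda>k. bernoulli_pmf (p k)))
      (\<lambda>I. (of_bool (I i) - p i) * (of_bool (I j) - p j)) = (if i = j then p i * (1 - p i) else 0)"
proof -
  let ?M = "Pi_pmf T False (\<lambda>k. bernoulli_pmf (p k))"
  have int: "integrable (measure_pmf ?M) f" for f :: "_ \<Rightarrow> real"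
    by (intro integrable_measure_pmf_finite finite_set_Pi_bernoulli fin)
  have "measure_pmf.expectation ?M (\<lambda>I. (of_bool (I i) - p i) * (of_bool (I j) - p j)) =
      measure_pmf.expectation ?M
        (\<lambda>I. of_bool (I i \<and> I j) - p j * of_bool (I i) - p i * of_bool (I j) + p i * p j)"
    by (intro Bochner_Integration.integral_cong) (auto simp: algebra_simps)
  also have "\<dots> = measure_pmf.prob ?M {I. I i \<and> I j} - p j * measure_pmf.prob ?M {I. I i}
      - p i * measure_pmf.prob ?M {I. I j} + p i * p j"
    by (simp add: int expectation_of_bool)
  also have "\<dots> = (if i = j then p i * (1 - p i) else 0)"
    using assms by (auto simp: prob_bernoulli_component prob_bernoulli_both algebra_simps)
  finally show ?thesis .
qed

text \<open>By bilinearity only pairwise covariances matter, and independence kills all but the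
  diagonal. The second moments of the error and of the normalizer are instances.\<close>

lemma expectation_inner_centred_bernoulli:
  fixes c d :: "'a \<Rightarrow> 'b::euclidean_space"
  assumes fin: "finite T" and p: "\<And>k. k \<in> T \<Longrightarrow> 0 \<le> p k \<and> p k \<le> 1"
  shows "measure_pmf.expectation (Pi_pmf T False (\<lambda>k. bernoulli_pmf (p k)))
      (\<lambda>I. (\<Sum>i\<in>T. (of_bool (I i) - p i) *\<^sub>R c i) \<bullet> (\<Sum>j\<in>T. (of_bool (I j) - p j) *\<^sub>R d j)) =
    (\<Sum>i\<in>T. p i * (1 - p i) * (c i \<bullet> d i))"
proof -
  let ?M = "Pi_pmf T False (\<lambda>k. bernoulli_pmf (p k))"
  have int: "integrable (measure_pmf ?M) f" for f :: "_ \<Rightarrow> real"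
    by (intro integrable_measure_pmf_finite finite_set_Pi_bernoulli fin)
  have "measure_pmf.expectation ?M
      (\<lambda>I. (\<Sum>i\<in>T. (of_bool (I i) - p i) *\<^sub>R c i) \<bullet> (\<Sum>j\<in>T. (of_bool (I j) - p j) *\<^sub>R d j)) =
    measure_pmf.expectation ?M
      (\<lambda>I. \<Sum>i\<in>T. \<Sum>j\<in>T. (c i \<bullet> d j) * ((of_bool (I i) - p i) * (of_bool (I j) - p j)))"
    by (subst inner_sum_left, subst inner_sum_right) (simp add: mult_ac)
  also have "\<dots> = (\<Sum>i\<in>T. \<Sum>j\<in>T. (c i \<bullet> d j) *
      measure_pmf.expectation ?M (\<lambda>I. (of_bool (I i) - p i) * (of_bool (I j) - p j)))"
    by (simp add: int)
  also have "\<dots> = (\<Sum>i\<in>T. \<Sum>j\<in>T. if i = j then p i * (1 - p i) * (c i \<bullet> d i) else 0)"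
    using assms by (intro sum.cong refl) (simp add: covariance_bernoulli)
  also have "\<dots> = (\<Sum>i\<in>T. p i * (1 - p i) * (c i \<bullet> d i))"
    using fin by simp
  finally show ?thesis .
qed

lemma expectation_sum_bernoulli:
  fixes c :: "'a \<Rightarrow> 'b::euclidean_space"
  assumes fin: "finite T" and p: "\<And>k. k \<in> T \<Longrightarrow> 0 \<le> p k \<and> p k \<le> 1"
  shows "measure_pmf.expectation (Pi_pmf T False (\<lambda>k. bernoulli_pmf (p k)))
      (\<lambda>I. \<Sum>i\<in>T. of_bool (I i) *\<^sub>R c i) = (\<Sum>i\<in>T. p i *\<^sub>R c i)"
proof -
  have int: "integrable (measure_pmf (Pi_pmf T False (\<lambda>k. bernoulli_pmf (p k)))) f"
    for f :: "_ \<Rightarrow> 'c::{banach, second_countable_topology}"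
    by (intro integrable_measure_pmf_finite finite_set_Pi_bernoulli fin)
  show ?thesis
    using assms
    by (subst Bochner_Integration.integral_sum)
      (simp_all add: int expectation_of_bool prob_bernoulli_component)
qed

text \<open>Chernoff bound on the lower tail with the exponent \<open>\<lambda> = 1 / (2 b)\<close>.\<close>

lemma prob_weighted_sum_less_half:
  fixes x p :: "'a \<Rightarrow> real"
  assumes fin: "finite T" and p: "\<And>k. k \<in> T \<Longrightarrow> 0 \<le> p k \<and> p k \<le> 1"
    and x: "\<And>k. k \<in> T \<Longrightarrow> 0 \<le> x k \<and> x k \<le> b" and b: "0 < b" and c: "0 \<le> c"
    and mean: "c + (\<Sum>i\<in>T. p i * x i) = 1"
  shows "measure_pmf.prob (Pi_pmf T False (\<lambda>k. bernoulli_pmf (p k)))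
      {I. c + (\<Sum>i\<in>T. of_bool (I i) * x i) < 1 / 2} \<le> exp (- 1 / (8 * b))"
proof -
  let ?M = "Pi_pmf T False (\<lambda>k. bernoulli_pmf (p k))"
  define l where "l = 1 / (2 * b)"
  have l: "l > 0" using b by (simp add: l_def)
  have int: "integrable (measure_pmf ?M) f" for f :: "_ \<Rightarrow> real"
    by (intro integrable_measure_pmf_finite finite_set_Pi_bernoulli fin)
  let ?R = "\<lambda>I. c + (\<Sum>i\<in>T. of_bool (I i) * x i)"
  have "measure_pmf.prob ?M {I. ?R I < 1 / 2} =
      measure_pmf.expectation ?M (\<lambda>I. of_bool (?R I < 1 / 2))"
    by (simp add: expectation_of_bool)
  \<comment> \<open>Exponential Markov inequality: the exponential is at least 1 on the event and
    positive elsewhere.\<close>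
  also have "\<dots> \<le> measure_pmf.expectation ?M (\<lambda>I. exp (l * (1/2 - ?R I)))"
    using l by (intro integral_mono int) (auto simp: of_bool_def)
  also have "\<dots> = measure_pmf.expectation ?M
      (\<lambda>I. exp (l * (1/2 - c)) * (\<Prod>i\<in>T. exp (- l * (of_bool (I i) * x i))))"
  proof (rule Bochner_Integration.integral_cong[OF refl])
    fix I
    have "l * (1/2 - ?R I) = l * (1/2 - c) + (\<Sum>i\<in>T. - l * (of_bool (I i) * x i))"
      by (simp add: sum_negf right_diff_distrib distrib_left flip: sum_distrib_left)
    then show "exp (l * (1/2 - ?R I)) =
        exp (l * (1/2 - c)) * (\<Prod>i\<in>T. exp (- l * (of_bool (I i) * x i)))"
      using fin by (simp only: exp_add exp_sum)
  qed
  \<comment> \<open>Independence factorizes the moment generating function.\<close>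
  also have "\<dots> = exp (l * (1/2 - c)) *
      (\<Prod>i\<in>T. measure_pmf.expectation (bernoulli_pmf (p i)) (\<lambda>v. exp (- l * (of_bool v * x i))))"
    by (subst expectation_prod_Pi_pmf[symmetric, OF fin])
      (auto intro: integrable_measure_pmf_finite)
  also have "\<dots> \<le> exp (l * (1/2 - c)) * (\<Prod>i\<in>T. exp (- (3/4) * l * (p i * x i)))"
  proof (intro mult_left_mono prod_mono conjI)
    fix i assume i: "i \<in> T"
    have "l * x i \<le> 1 / 2" using x[OF i] b by (simp add: l_def field_simps)
    moreover have lx: "0 \<le> l * x i" using x[OF i] l by simp
    ultimately have sq: "(l * x i)\<^sup>2 \<le> (l * x i) / 2"
      using mult_left_mono[of "l * x i" "1/2" "l * x i"] by (simp add: power2_eq_square)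
    \<comment> \<open>The cubic Taylor remainder is nonpositive. As \<open>l * x i\<close> is at
      most 1/2, the quadratic term costs at most a quarter of the linear one, hence the factor 3/4
      below.\<close>
    have "exp (- (l * x i)) \<le> 1 - l * x i + (l * x i)\<^sup>2 / 2"
    proof -
      obtain t where "exp (- (l * x i)) = (\<Sum>m<3. (- (l * x i)) ^ m / fact m) +
          exp t / fact 3 * (- (l * x i)) ^ 3"
        using Maclaurin_exp_le[of "- (l * x i)" 3] by auto
      moreover have "exp t / fact 3 * (- (l * x i)) ^ 3 \<le> 0"
        using lx by (intro mult_nonneg_nonpos) auto
      ultimately show ?thesis by (simp add: eval_nat_numeral)
    qed
    then have "exp (- (l * x i)) \<le> 1 - 3/4 * (l * x i)" using sq by linarith
    then have "p i * exp (- (l * x i)) \<le> p i * (1 - 3/4 * (l * x i))"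
      using p[OF i] by (intro mult_left_mono) auto
    then have "exp (- (l * x i)) * p i + (1 - p i) \<le> 1 + (- (3/4) * l * (p i * x i))"
      by (simp add: algebra_simps)
    also have "\<dots> \<le> exp (- (3/4) * l * (p i * x i))" by (rule exp_ge_add_one_self)
    finally show "measure_pmf.expectation (bernoulli_pmf (p i)) (\<lambda>v. exp (- l * (of_bool v * x i)))
        \<le> exp (- (3/4) * l * (p i * x i))"
      using p[OF i] by simp
  qed simp_all
  also have "\<dots> = exp (l * (1/2 - c) + - (3/4) * l * (\<Sum>i\<in>T. p i * x i))"
    using fin by (simp only: exp_add exp_sum sum_distrib_left)
  also have "(\<Sum>i\<in>T. p i * x i) = 1 - c" using mean by simp
  \<comment> \<open>The left side is \<open>- l / 4 - l * c / 4\<close>, and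
    \<open>l / 4 = 1 / (8 * b)\<close>.\<close>
  also have "l * (1/2 - c) + - (3/4) * l * (1 - c) \<le> - 1 / (8 * b)"
    using l c by (simp add: l_def field_simps)
  finally show ?thesis by simp
qed

text \<open>The quadratic Taylor term suffices: \<open>exp t\<close> is at least
  \<open>t^2 / 2\<close>, and \<open>t = 1 / (8 * b)\<close> turns \<open>2 / t^2\<close> into
  \<open>128 * b^2\<close>.\<close>

lemma exp_minus_inverse_le:
  assumes "0 < (b::real)"
  shows "exp (- 1 / (8 * b)) \<le> 128 * b\<^sup>2"
proof -
  define t where "t = 1 / (8 * b)"
  have t: "t > 0" using assms by (simp add: t_def)
  have "t\<^sup>2 / 2 \<le> exp t" using exp_lower_Taylor_quadratic[of t] t by simp
  then have "exp (- t) \<le> 2 / t\<^sup>2" using t by (simp add: exp_minus field_simps)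
  then show ?thesis using assms by (simp add: t_def field_simps power2_eq_square)
qed

section \<open>Programs for sums\<close>

fun sum_prog :: "'x program list \<Rightarrow> 'x program" where
  "sum_prog [] = Const 0"
| "sum_prog (e # es) = Add e (sum_prog es)"

lemma run_sum_prog: "run \<rho> (sum_prog es) = (\<Sum>e\<leftarrow>es. run \<rho> e)"
  by (induction es) auto

lemma inputs_sum_prog: "inputs (sum_prog es) = (\<Union>e\<in>set es. inputs e)"
  by (induction es) auto

lemma ops_sum_prog: "ops (sum_prog es) = (\<Sum>e\<leftarrow>es. Suc (ops e))"
  by (induction es) auto

text \<open>Addition of programs is binary while token sets are unordered, so an arbitrary
  duplicate-free enumeration fixes an order; value and cost of a finite sum do not depend on
  it.\<close>

definition sum_over :: "'a set \<Rightarrow> ('a \<Rightarrow> 'x program) \<Rightarrow> 'x program" where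
  "sum_over U f = sum_prog (map f (SOME xs. set xs = U \<and> distinct xs))"

lemma enumeration:
  assumes "finite U"
  shows "set (SOME xs. set xs = U \<and> distinct xs) = U" "distinct (SOME xs. set xs = U \<and> distinct xs)"
  using someI_ex[OF finite_distinct_list[OF assms]] by auto

lemma run_sum_over: "finite U \<Longrightarrow> run \<rho> (sum_over U f) = (\<Sum>i\<in>U. run \<rho> (f i))"
  using enumeration[of U]
  by (simp add: sum_over_def run_sum_prog o_def sum_list_distinct_conv_sum_set)

lemma inputs_sum_over_subset:
  "finite U \<Longrightarrow> (\<And>i. i \<in> U \<Longrightarrow> inputs (f i) \<subseteq> D) \<Longrightarrow> inputs (sum_over U f) \<subseteq> D"
  using enumeration[of U] by (auto simp: sum_over_def inputs_sum_prog)

lemma ops_sum_over: "finite U \<Longrightarrow> ops (sum_over U f) = (\<Sum>i\<in>U. Suc (ops (f i)))"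
  using enumeration[of U]
  by (simp add: sum_over_def ops_sum_prog o_def sum_list_distinct_conv_sum_set)

section \<open>Programs for the weights, the normalizer and the output\<close>

text \<open>Weights are not stored and are recomputed from query and key; the dimension is fixed by
  the type, so its square root is a constant.\<close>

definition weight_prog :: "nat \<Rightarrow> ('d::finite, 'p::finite) datum program" where
  "weight_prog i = Exp (Div (sum_over UNIV (\<lambda>c. Mul (Input (Query c)) (Input (Key i c))))
     (Const (sqrt (real CARD('d)))))"

lemma stored_data_simps [simp]:
  "Query c \<in> stored_data U" "Key i c \<in> stored_data U \<longleftrightarrow> i \<in> U"
  "Val i v \<in> stored_data U \<longleftrightarrow> i \<in> U" "Prob i \<in> stored_data U \<longleftrightarrow> i \<in> U"
  by (auto simp: stored_data_def image_iff)

lemma run_weight_prog: "run (read_datum X I) (weight_prog i) = weight X i"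
  by (simp add: weight_prog_def run_sum_over weight_def attn_score_def inner_vec_def)

lemma inputs_weight_prog: "i \<in> U \<Longrightarrow> inputs (weight_prog i) \<subseteq> stored_data U"
  by (simp add: weight_prog_def inputs_sum_over_subset)

definition inv_weight_prog :: "nat \<Rightarrow> ('d::finite, 'p::finite) datum program" where
  "inv_weight_prog i = Div (weight_prog i) (Input (Prob i))"

lemma run_inv_weight_prog: "run (read_datum X I) (inv_weight_prog i) = weight X i / incl_prob X i"
  by (simp add: inv_weight_prog_def run_weight_prog)

lemma inputs_inv_weight_prog: "i \<in> U \<Longrightarrow> inputs (inv_weight_prog i) \<subseteq> stored_data U"
  by (simp add: inv_weight_prog_def inputs_weight_prog)

text \<open>\<open>norm_prog\<close> and \<open>out_prog\<close> serve the computability claim,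
  which starts from stored tokens only; the cost claim reads both quantities as inputs.\<close>

definition norm_prog :: "nat set \<Rightarrow> ('d::finite, 'p::finite) datum program" where
  "norm_prog S = sum_over S inv_weight_prog"

definition out_prog :: "nat set \<Rightarrow> 'p \<Rightarrow> ('d::finite, 'p::finite) datum program" where
  "out_prog S c = Div (sum_over S (\<lambda>i. Mul (inv_weight_prog i) (Input (Val i c)))) (norm_prog S)"

lemma run_norm_prog:
  "finite (retained X I) \<Longrightarrow>
    run (read_datum X I) (norm_prog (retained X I)) = total_weight_est X I"
  by (simp add: norm_prog_def run_sum_over run_inv_weight_prog total_weight_est_def)

lemma run_out_prog:
  "finite (retained X I) \<Longrightarrow> run (read_datum X I) (out_prog (retained X I) c) = hajek X I $ c"
  by (simp add: out_prog_def run_sum_over run_inv_weight_prog run_norm_prog hajek_def)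

lemma inputs_norm_prog: "finite S \<Longrightarrow> inputs (norm_prog S) \<subseteq> stored_data S"
  by (simp add: norm_prog_def inputs_sum_over_subset inputs_inv_weight_prog)

lemma inputs_out_prog: "finite S \<Longrightarrow> inputs (out_prog S c) \<subseteq> stored_data S"
  by (simp add: out_prog_def inputs_norm_prog inputs_sum_over_subset inputs_inv_weight_prog)

section \<open>Programs for the variance estimator and their cost\<close>

definition square_prog :: "'x program \<Rightarrow> 'x program" where
  "square_prog e = Mul e e"

lemma run_square_prog: "run \<rho> (square_prog e) = (run \<rho> e)\<^sup>2"
  by (simp add: square_prog_def power2_eq_square)

text \<open>The factor \<open>1 / n\<^sup>2\<close> of the estimator is moved into every summand, so that the empty
  sum costs nothing.\<close>

definition var_term_prog ::
  "('d::finite, 'p::finite) datum program \<Rightarrow> ('p \<Rightarrow> ('d, 'p) datum program) \<Rightarrow> nat \<Rightarrow> ('d, 'p) datum program"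
  where
  "var_term_prog n h i =
     Div (Mul (Mul (Sub (Const 1) (Input (Prob i))) (square_prog (inv_weight_prog i)))
            (sum_over UNIV (\<lambda>c. square_prog (Sub (Input (Val i c)) (h c)))))
       (square_prog n)"

text \<open>An infinite set has no enumeration; the constant keeps the set of inputs under control
  for every \<open>U\<close>.\<close>

definition var_prog ::
  "('d::finite, 'p::finite) datum program \<Rightarrow> ('p \<Rightarrow> ('d, 'p) datum program) \<Rightarrow> nat set \<Rightarrow> ('d, 'p) datum program"
  where "var_prog n h U = (if finite U then sum_over U (var_term_prog n h) else Const 0)"

text \<open>Generic in \<open>n\<close> and \<open>h\<close> because two versions are needed: one
  recomputes normalizer and output, the other reads them.\<close>

lemma run_var_prog:
  fixes X :: "('d::finite, 'p::finite) eviction"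
  assumes fin: "finite (retained X I \<inter> tail X)"
    and n: "run (read_datum X I) n = total_weight_est X I"
    and h: "\<And>c. run (read_datum X I) (h c) = hajek X I $ c"
  shows "run (read_datum X I) (var_prog n h (retained X I \<inter> tail X)) = var_est X I"
proof -
  have "(\<Sum>c\<in>UNIV. (val X i $ c - hajek X I $ c)\<^sup>2) = (norm (val X i - hajek X I))\<^sup>2" for i
    by (simp only: power2_norm_eq_inner inner_vec_def) (simp add: power2_eq_square)
  then have "run (read_datum X I) (var_term_prog n h i) = (1 - incl_prob X i) *
      (weight X i / incl_prob X i)\<^sup>2 * (norm (val X i - hajek X I))\<^sup>2 / (total_weight_est X I)\<^sup>2" for i
    using n h by (simp add: var_term_prog_def run_sum_over run_square_prog run_inv_weight_prog)
  then show ?thesis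
    using fin
    by (simp add: var_prog_def run_sum_over var_est_def sum_divide_distrib power_divide)
qed

lemma inputs_var_prog:
  assumes "inputs n \<subseteq> D" "\<And>c. inputs (h c) \<subseteq> D" "stored_data U \<subseteq> D"
  shows "inputs (var_prog n h U) \<subseteq> D"
proof (cases "finite U")
  case True
  have "inputs (var_term_prog n h i) \<subseteq> D" if "i \<in> U" for i
  proof -
    have "inputs (inv_weight_prog i) \<subseteq> D" "Prob i \<in> D" "\<And>c. Val i c \<in> D"
      using assms(3) inputs_inv_weight_prog[OF that] that by (auto intro!: subsetD[OF assms(3)])
    then show ?thesis
      using assms(1,2) by (simp add: var_term_prog_def square_prog_def inputs_sum_over_subset)
  qed
  then show ?thesis using True by (simp add: var_prog_def inputs_sum_over_subset)
qed (simp add: var_prog_def)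

text \<open>Summands for different tokens have the same shape, so token 0 can represent their common
  cost; \<open>Suc\<close> counts the addition that attaches a summand.\<close>

lemma ops_var_prog:
  assumes "finite U"
  shows "ops (var_prog n h U) = Suc (ops (var_term_prog n h 0)) * card U"
proof -
  have "ops (var_term_prog n h i) = ops (var_term_prog n h 0)" for i
    by (simp add: var_term_prog_def square_prog_def inv_weight_prog_def weight_prog_def ops_sum_over)
  then have "(\<Sum>i\<in>U. Suc (ops (var_term_prog n h i))) = (\<Sum>i\<in>U. Suc (ops (var_term_prog n h 0)))"
    by (intro sum.cong refl arg_cong[where f = Suc])
  then show ?thesis using assms by (simp add: var_prog_def ops_sum_over)
qed

section \<open>Moments under the Poisson design\<close>

locale poisson_cache =
  fixes X :: "('d::finite, 'p::finite) eviction"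
  assumes eviction: "poisson_eviction X" and design: "known_design X"
begin

text \<open>The x_i of the overview. Times the inclusion probability it is the exact normalized
  attention weight.\<close>

definition rel_weight :: "nat \<Rightarrow> real" where
  "rel_weight i = weight X i / (incl_prob X i * total_weight X)"

definition centred_val :: "nat \<Rightarrow> real^'p" where
  "centred_val i = val X i - head_output X"

definition norm_ratio :: "(nat \<Rightarrow> bool) \<Rightarrow> real" where
  "norm_ratio I = total_weight_est X I / total_weight X"

definition var_coeff :: "nat \<Rightarrow> real" where
  "var_coeff i = (1 - incl_prob X i) * (rel_weight i)\<^sup>2"

text \<open>\<open>moment0\<close>, \<open>moment1\<close> and \<open>moment2\<close> are q_0, q_1
  and q_2 of the overview.\<close>

definition moment0 :: "(nat \<Rightarrow> bool) \<Rightarrow> real" where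
  "moment0 I = (\<Sum>i\<in>tail X. of_bool (I i) * var_coeff i)"

definition moment1 :: "(nat \<Rightarrow> bool) \<Rightarrow> real^'p" where
  "moment1 I = (\<Sum>i\<in>tail X. of_bool (I i) *\<^sub>R (var_coeff i *\<^sub>R centred_val i))"

definition moment2 :: "(nat \<Rightarrow> bool) \<Rightarrow> real" where
  "moment2 I = (\<Sum>i\<in>tail X. of_bool (I i) *\<^sub>R (var_coeff i * (norm (centred_val i))\<^sup>2))"

text \<open>The deterministic share of r: certainty tokens are always retained.\<close>

definition cert_part :: real where
  "cert_part = (\<Sum>i\<in>cert X. rel_weight i)"

section \<open>Certainty set, tail and inclusion probabilities\<close>

lemma finite_cache [simp]: "finite (cache X)"
  by (simp add: cache_def)

lemma finite_tail [simp]: "finite (tail X)"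
  by (simp add: tail_def)

lemma cert_subset: "cert X \<subseteq> cache X"
  using eviction by (simp add: poisson_eviction_def)

lemma finite_cert [simp]: "finite (cert X)"
  using cert_subset finite_cache by (rule finite_subset)

lemma cache_eq: "cache X = cert X \<union> tail X" and disjoint: "cert X \<inter> tail X = {}"
  using cert_subset by (auto simp: tail_def)

lemma cache_nonempty: "cache X \<noteq> {}"
  using eviction by (simp add: poisson_eviction_def cache_def)

lemma retained_subset: "retained X I \<subseteq> cache X"
  by (auto simp: retained_def cache_eq)

lemma finite_retained [simp]: "finite (retained X I)"
  using retained_subset finite_cache by (rule finite_subset)

lemma retained_tail: "retained X I \<inter> tail X = {i \<in> tail X. I i}"
  using disjoint by (auto simp: retained_def)

text \<open>Lets a program that is given the certainty set and the retained set find the retained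
  tail.\<close>

lemma retained_diff_cert: "retained X I - cert X = retained X I \<inter> tail X"
  using disjoint by (auto simp: retained_def)

lemma weight_pos: "0 < weight X i"
  by (simp add: weight_def)

lemma total_weight_pos: "0 < total_weight X"
  unfolding total_weight_def using cache_nonempty by (intro sum_pos) (auto simp: weight_pos)

lemma incl_prob_cert: "i \<in> cert X \<Longrightarrow> incl_prob X i = 1"
  by (simp add: incl_prob_def)

lemma incl_prob_le_1: "incl_prob X i \<le> 1"
  by (simp add: incl_prob_def clip_def)

lemma incl_prob_pos: "i \<in> tail X \<Longrightarrow> 0 < incl_prob X i"
  using eviction design by (fastforce simp: poisson_eviction_def known_design_def)

lemma incl_prob_pos_cache: "i \<in> cache X \<Longrightarrow> 0 < incl_prob X i"
  using incl_prob_pos incl_prob_cert by (auto simp: cache_eq)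

lemma incl_prob_range: "i \<in> tail X \<Longrightarrow> 0 \<le> incl_prob X i \<and> incl_prob X i \<le> 1"
  using incl_prob_pos incl_prob_le_1 by (simp add: less_imp_le)

lemma rel_weight_nonneg: "i \<in> cache X \<Longrightarrow> 0 \<le> rel_weight i"
  using incl_prob_pos_cache[of i] weight_pos[of i] total_weight_pos by (simp add: rel_weight_def)

lemma incl_prob_rel_weight:
  "i \<in> cache X \<Longrightarrow> incl_prob X i * rel_weight i = weight X i / total_weight X"
  using incl_prob_pos_cache[of i] by (simp add: rel_weight_def)

lemma sum_retained:
  fixes f :: "nat \<Rightarrow> 'a::real_vector"
  shows "(\<Sum>i\<in>retained X I. f i) = (\<Sum>i\<in>cert X. f i) + (\<Sum>i\<in>tail X. of_bool (I i) *\<^sub>R f i)"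
proof -
  have "(\<Sum>i\<in>retained X I. f i) = (\<Sum>i\<in>cert X. f i) + (\<Sum>i\<in>{i \<in> tail X. I i}. f i)"
    unfolding retained_def using disjoint by (intro sum.union_disjoint) auto
  also have "(\<Sum>i\<in>{i \<in> tail X. I i}. f i) = (\<Sum>i\<in>tail X. of_bool (I i) *\<^sub>R f i)"
    by (rule sum.mono_neutral_cong_left) auto
  finally show ?thesis .
qed

section \<open>Normalizer and linearized error as sums over retained tokens\<close>

lemma norm_ratio_retained: "norm_ratio I = (\<Sum>i\<in>retained X I. rel_weight i)"
  by (simp add: norm_ratio_def total_weight_est_def rel_weight_def sum_divide_distrib)

lemma norm_ratio_eq: "norm_ratio I = cert_part + (\<Sum>i\<in>tail X. of_bool (I i) * rel_weight i)"
  by (simp add: norm_ratio_retained sum_retained cert_part_def)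

lemma norm_ratio_nonneg: "0 \<le> norm_ratio I"
  unfolding norm_ratio_retained
  using rel_weight_nonneg retained_subset by (intro sum_nonneg) auto

lemma total_weight_est_eq: "total_weight_est X I = norm_ratio I * total_weight X"
  using total_weight_pos by (simp add: norm_ratio_def)

text \<open>Unbiasedness of the estimated normalizer: the inclusion probability cancels and the true
  normalized weights remain.\<close>

lemma mean_norm_ratio: "cert_part + (\<Sum>i\<in>tail X. incl_prob X i * rel_weight i) = 1"
proof -
  have "1 = (\<Sum>i\<in>cache X. weight X i / total_weight X)"
    using total_weight_pos by (simp add: total_weight_def flip: sum_divide_distrib)
  also have "\<dots> = (\<Sum>i\<in>cache X. incl_prob X i * rel_weight i)"
    by (simp add: incl_prob_rel_weight)
  also have "\<dots> = cert_part + (\<Sum>i\<in>tail X. incl_prob X i * rel_weight i)"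
    using disjoint by (simp add: cache_eq sum.union_disjoint cert_part_def incl_prob_cert)
  finally show ?thesis ..
qed

lemma cert_part_nonneg: "0 \<le> cert_part"
  unfolding cert_part_def using rel_weight_nonneg cert_subset by (intro sum_nonneg) auto

lemma norm_ratio_minus_1:
  "norm_ratio I - 1 = (\<Sum>i\<in>tail X. (of_bool (I i) - incl_prob X i) *\<^sub>R rel_weight i)"
  using mean_norm_ratio by (simp add: norm_ratio_eq left_diff_distrib sum_subtractf)

lemma lin_error_centred:
  "lin_error X I = (\<Sum>i\<in>tail X. (of_bool (I i) - incl_prob X i) *\<^sub>R (rel_weight i *\<^sub>R centred_val i))"
proof -
  have "(of_bool (I i) / incl_prob X i - 1) * weight X i / total_weight X =
      (of_bool (I i) - incl_prob X i) * rel_weight i" if "i \<in> tail X" for i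
    using incl_prob_pos[OF that] total_weight_pos by (simp add: rel_weight_def field_simps)
  then show ?thesis
    by (simp add: lin_error_def scaleR_sum_right centred_val_def)
qed

lemma head_output_eq: "head_output X = (\<Sum>i\<in>cache X. (weight X i / total_weight X) *\<^sub>R val X i)"
  by (simp add: head_output_def scaleR_sum_right)

text \<open>The head output is the mean of the values under the normalized weights, so deviations
  from it average to zero.\<close>

lemma sum_centred_val: "(\<Sum>i\<in>cache X. (incl_prob X i * rel_weight i) *\<^sub>R centred_val i) = 0"
proof -
  have "(\<Sum>i\<in>cache X. weight X i / total_weight X) = 1"
    using total_weight_pos by (simp add: total_weight_def flip: sum_divide_distrib)
  then have "(\<Sum>i\<in>cache X. (weight X i / total_weight X) *\<^sub>R centred_val i) = 0"
    by (simp add: centred_val_def scaleR_diff_right sum_subtractf head_output_eq[symmetric]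
        flip: scaleR_sum_left)
  then show ?thesis by (simp add: incl_prob_rel_weight)
qed

text \<open>Centring subtracts the expected tail contribution, and by \<open>sum_centred_val\<close>
  this is minus the contribution of the certainty set. So the certainty tokens can be included and
  the centring dropped.\<close>

lemma lin_error_retained: "lin_error X I = (\<Sum>i\<in>retained X I. rel_weight i *\<^sub>R centred_val i)"
proof -
  have "(\<Sum>i\<in>cert X. rel_weight i *\<^sub>R centred_val i) +
      (\<Sum>i\<in>tail X. (incl_prob X i * rel_weight i) *\<^sub>R centred_val i) = 0"
    using sum_centred_val disjoint by (simp add: cache_eq sum.union_disjoint incl_prob_cert)
  then show ?thesis
    by (simp add: lin_error_centred sum_retained left_diff_distrib scaleR_diff_left sum_subtractf
        algebra_simps eq_neg_iff_add_eq_0)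
qed

text \<open>Exact, not just first order, because e equals the retained sum of x_i v_i minus r y. At
  r = 0 the default value of \<open>hajek\<close> would break it.\<close>

lemma hajek_error:
  assumes "norm_ratio I \<noteq> 0"
  shows "hajek X I - head_output X = (1 / norm_ratio I) *\<^sub>R lin_error X I"
proof -
  have "hajek X I = (1 / norm_ratio I) *\<^sub>R (\<Sum>i\<in>retained X I. rel_weight i *\<^sub>R val X i)"
    by (simp add: hajek_def total_weight_est_eq scaleR_sum_right rel_weight_def mult_ac)
  moreover have "lin_error X I =
      (\<Sum>i\<in>retained X I. rel_weight i *\<^sub>R val X i) - norm_ratio I *\<^sub>R head_output X"
    by (simp add: lin_error_retained centred_val_def scaleR_diff_right sum_subtractf
        norm_ratio_retained scaleR_sum_left)
  ultimately show ?thesis using assms by (simp add: scaleR_diff_right)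
qed

section \<open>Pathwise bounds by the value scale\<close>

lemma norm_val_le: "i \<in> cache X \<Longrightarrow> norm (val X i) \<le> value_scale X"
  by (simp add: value_scale_def)

lemma value_scale_nonneg: "0 \<le> value_scale X"
  using cache_nonempty norm_val_le norm_ge_zero order_trans by blast

lemma norm_head_output_le: "norm (head_output X) \<le> value_scale X"
proof -
  have "norm (head_output X) \<le> (\<Sum>i\<in>cache X. weight X i / total_weight X * value_scale X)"
    unfolding head_output_eq
    using norm_val_le weight_pos total_weight_pos
    by (intro sum_norm_le) (simp add: divide_right_mono mult_left_mono less_imp_le)
  also have "\<dots> = value_scale X"
    using total_weight_pos
    by (simp add: total_weight_def flip: sum_divide_distrib sum_distrib_right)
  finally show ?thesis .
qed

text \<open>The estimator is a convex combination of retained values, or the default 0 when its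
  normalizer vanishes.\<close>

lemma norm_hajek_le: "norm (hajek X I) \<le> value_scale X"
proof (cases "total_weight_est X I = 0")
  case False
  have nonneg: "0 \<le> weight X i / incl_prob X i" if "i \<in> retained X I" for i
    using weight_pos[of i] incl_prob_pos_cache[of i] retained_subset[of I] that
    by (simp add: less_imp_le subset_iff)
  then have pos: "0 < total_weight_est X I"
    using False by (simp add: total_weight_est_def sum_nonneg less_le)
  have "norm (\<Sum>i\<in>retained X I. (weight X i / incl_prob X i) *\<^sub>R val X i) \<le>
      (\<Sum>i\<in>retained X I. weight X i / incl_prob X i * value_scale X)"
  proof (rule sum_norm_le)
    fix i assume i: "i \<in> retained X I"
    then have "norm (val X i) \<le> value_scale X" using norm_val_le retained_subset by blast
    then show "norm ((weight X i / incl_prob X i) *\<^sub>R val X i) \<le>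
        weight X i / incl_prob X i * value_scale X"
      using mult_left_mono[OF _ nonneg[OF i]] nonneg[OF i] by (simp only: norm_scaleR abs_of_nonneg)
  qed
  then have "norm (\<Sum>i\<in>retained X I. (weight X i / incl_prob X i) *\<^sub>R val X i) \<le>
      total_weight_est X I * value_scale X"
    by (simp add: total_weight_est_def sum_distrib_right)
  then show ?thesis using pos by (simp add: hajek_def field_simps)
qed (simp add: hajek_def value_scale_nonneg)

lemma norm_centred_val_le: "i \<in> cache X \<Longrightarrow> norm (centred_val i) \<le> 2 * value_scale X"
  unfolding centred_val_def
  using norm_triangle_ineq4[of "val X i" "head_output X"] norm_val_le[of i] norm_head_output_le
  by linarith

lemma norm_centred_val_sq_le: "i \<in> cache X \<Longrightarrow> (norm (centred_val i))\<^sup>2 \<le> 4 * (value_scale X)\<^sup>2"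
  using power_mono[OF norm_centred_val_le, of i 2] by (simp add: power_mult_distrib)

lemma tail_in_cache: "i \<in> tail X \<Longrightarrow> i \<in> cache X"
  by (simp add: cache_eq)

lemma var_coeff_nonneg: "0 \<le> var_coeff i"
  using incl_prob_le_1[of i] by (simp add: var_coeff_def)

lemma var_coeff_le: "i \<in> tail X \<Longrightarrow> var_coeff i \<le> (rel_weight i)\<^sup>2"
  using incl_prob_pos[of i] by (simp add: var_coeff_def mult_left_le_one_le incl_prob_le_1)

text \<open>The sum over retained tokens makes the bound proportional to r, which controls e on the
  event r < 1/2.\<close>

lemma norm_lin_error_le: "norm (lin_error X I) \<le> 2 * value_scale X * norm_ratio I"
proof -
  have "norm (lin_error X I) \<le> (\<Sum>i\<in>retained X I. rel_weight i * (2 * value_scale X))"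
    unfolding lin_error_retained
  proof (rule sum_norm_le)
    fix i assume "i \<in> retained X I"
    then have "i \<in> cache X" using retained_subset by blast
    then show "norm (rel_weight i *\<^sub>R centred_val i) \<le> rel_weight i * (2 * value_scale X)"
      using rel_weight_nonneg norm_centred_val_le by (simp add: mult_left_mono)
  qed
  then show ?thesis by (simp add: norm_ratio_retained mult.commute flip: sum_distrib_right)
qed

lemma var_est_eq_0: "norm_ratio I = 0 \<Longrightarrow> var_est X I = 0"
  by (simp add: var_est_def total_weight_est_eq)

text \<open>The true normalizer cancels, and indicators replace the random index set by the fixed
  tail.\<close>

lemma var_est_rel_weight:
  "var_est X I = 1 / (norm_ratio I)\<^sup>2 *
    (\<Sum>i\<in>tail X. of_bool (I i) * (var_coeff i * (norm (val X i - hajek X I))\<^sup>2))"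
proof -
  have "(1 - incl_prob X i) / (incl_prob X i)\<^sup>2 * (weight X i)\<^sup>2 =
      (total_weight X)\<^sup>2 * var_coeff i" for i
    using total_weight_pos by (simp add: var_coeff_def rel_weight_def power_divide power_mult_distrib)
  then have "var_est X I = 1 / (norm_ratio I * total_weight X)\<^sup>2 * ((total_weight X)\<^sup>2 *
      (\<Sum>i\<in>retained X I \<inter> tail X. var_coeff i * (norm (val X i - hajek X I))\<^sup>2))"
    by (simp add: var_est_def total_weight_est_eq sum_distrib_left mult_ac)
  also have "(\<Sum>i\<in>retained X I \<inter> tail X. var_coeff i * (norm (val X i - hajek X I))\<^sup>2) =
      (\<Sum>i\<in>tail X. of_bool (I i) * (var_coeff i * (norm (val X i - hajek X I))\<^sup>2))"
    unfolding retained_tail by (rule sum.mono_neutral_cong_left) auto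
  finally show ?thesis using total_weight_pos by (simp add: power_mult_distrib)
qed

lemma var_est_nonneg: "0 \<le> var_est X I"
  unfolding var_est_rel_weight by (intro mult_nonneg_nonneg sum_nonneg) (auto simp: var_coeff_nonneg)

text \<open>The factor \<open>1 / r^2\<close> is harmless even for small r: the squares of the
  retained relative weights sum to at most \<open>r^2\<close>.\<close>

lemma var_est_le: "var_est X I \<le> 4 * (value_scale X)\<^sup>2"
proof (cases "norm_ratio I = 0")
  case False
  have "of_bool (I i) * (var_coeff i * (norm (val X i - hajek X I))\<^sup>2) \<le>
      (of_bool (I i) * rel_weight i)\<^sup>2 * (4 * (value_scale X)\<^sup>2)" if i: "i \<in> tail X" for i
  proof -
    have "norm (val X i - hajek X I) \<le> 2 * value_scale X"
      using norm_triangle_ineq4[of "val X i" "hajek X I"] norm_val_le[OF tail_in_cache[OF i]]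
        norm_hajek_le[of I] by linarith
    then have "(norm (val X i - hajek X I))\<^sup>2 \<le> (2 * value_scale X)\<^sup>2"
      by (intro power_mono) auto
    then have "var_coeff i * (norm (val X i - hajek X I))\<^sup>2 \<le>
        (rel_weight i)\<^sup>2 * (2 * value_scale X)\<^sup>2"
      using var_coeff_le[OF i] by (intro mult_mono) auto
    then show ?thesis by (auto simp: of_bool_def power_mult_distrib)
  qed
  then have "(\<Sum>i\<in>tail X. of_bool (I i) * (var_coeff i * (norm (val X i - hajek X I))\<^sup>2)) \<le>
      (\<Sum>i\<in>tail X. (of_bool (I i) * rel_weight i)\<^sup>2) * (4 * (value_scale X)\<^sup>2)"
    unfolding sum_distrib_right by (rule sum_mono)
  \<comment> \<open>One factor of each square is bounded by r, of which it is a summand.\<close>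
  also have "(\<Sum>i\<in>tail X. (of_bool (I i) * rel_weight i)\<^sup>2) \<le>
      (\<Sum>i\<in>tail X. of_bool (I i) * rel_weight i * norm_ratio I)"
  proof (rule sum_mono)
    fix i assume i: "i \<in> tail X"
    have "of_bool (I i) * rel_weight i \<le> (\<Sum>i\<in>tail X. of_bool (I i) * rel_weight i)"
      using i rel_weight_nonneg tail_in_cache by (intro member_le_sum) auto
    also have "\<dots> \<le> norm_ratio I" using cert_part_nonneg by (simp add: norm_ratio_eq)
    finally show "(of_bool (I i) * rel_weight i)\<^sup>2 \<le> of_bool (I i) * rel_weight i * norm_ratio I"
      using rel_weight_nonneg[OF tail_in_cache[OF i]]
      by (auto simp: of_bool_def power2_eq_square mult_left_mono)
  qed
  also have "\<dots> \<le> (norm_ratio I)\<^sup>2"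
    using cert_part_nonneg norm_ratio_nonneg[of I]
    by (simp add: norm_ratio_eq power2_eq_square mult_right_mono flip: sum_distrib_right)
  finally have "(\<Sum>i\<in>tail X. of_bool (I i) * (var_coeff i * (norm (val X i - hajek X I))\<^sup>2)) \<le>
      (norm_ratio I)\<^sup>2 * (4 * (value_scale X)\<^sup>2)" by (simp add: mult_right_mono)
  then show ?thesis using False by (simp add: var_est_rel_weight field_simps)
qed (simp add: var_est_eq_0)

text \<open>Substitute \<open>hajek - y = e / r\<close> and expand each squared norm.\<close>

lemma var_est_moments:
  assumes "norm_ratio I \<noteq> 0"
  shows "var_est X I = moment2 I / (norm_ratio I)\<^sup>2
    - 2 * (moment1 I \<bullet> lin_error X I) / (norm_ratio I) ^ 3
    + moment0 I * (norm (lin_error X I))\<^sup>2 / (norm_ratio I) ^ 4"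
proof -
  let ?r = "norm_ratio I" and ?e = "lin_error X I"
  have sq: "(norm (val X i - hajek X I))\<^sup>2 = (norm (centred_val i))\<^sup>2
      - 2 / ?r * (centred_val i \<bullet> ?e) + (norm ?e)\<^sup>2 / ?r\<^sup>2" for i
  proof -
    have "val X i - hajek X I = centred_val i - (1 / ?r) *\<^sub>R ?e"
      using hajek_error[OF assms] by (simp add: centred_val_def algebra_simps)
    then show ?thesis
      unfolding power2_norm_eq_inner
      by (simp only:)
        (simp add: inner_diff_left inner_diff_right inner_commute power2_eq_square algebra_simps)
  qed
  have "(\<Sum>i\<in>tail X. of_bool (I i) * (var_coeff i * (norm (val X i - hajek X I))\<^sup>2)) =
      moment2 I - 2 / ?r * (moment1 I \<bullet> ?e) + (norm ?e)\<^sup>2 / ?r\<^sup>2 * moment0 I"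
    unfolding sq moment0_def moment1_def moment2_def
    by (simp add: inner_sum_left sum_distrib_left sum_distrib_right algebra_simps sum.distrib
        sum_subtractf sum_divide_distrib del: sum_of_bool_mult_eq sum_mult_of_bool_eq)
  then show ?thesis
    using assms by (simp add: var_est_rel_weight field_simps eval_nat_numeral)
qed

section \<open>Expectations of linear and quadratic forms in the indicators\<close>

lemma integrable_design:
  fixes f :: "_ \<Rightarrow> 'b::{banach, second_countable_topology}"
  shows "integrable (measure_pmf (poisson_design X)) f"
  unfolding poisson_design_def
  by (intro integrable_measure_pmf_finite finite_set_Pi_bernoulli) simp

lemma expectation_inner_centred:
  fixes c d :: "nat \<Rightarrow> 'b::euclidean_space"
  shows "measure_pmf.expectation (poisson_design X)
      (\<lambda>I. (\<Sum>i\<in>tail X. (of_bool (I i) - incl_prob X i) *\<^sub>R c i) \<bullet>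
           (\<Sum>i\<in>tail X. (of_bool (I i) - incl_prob X i) *\<^sub>R d i)) =
    (\<Sum>i\<in>tail X. incl_prob X i * (1 - incl_prob X i) * (c i \<bullet> d i))"
  unfolding poisson_design_def
  by (rule expectation_inner_centred_bernoulli[OF finite_tail incl_prob_range])

lemma expectation_sum_design:
  fixes c :: "nat \<Rightarrow> 'b::euclidean_space"
  shows "measure_pmf.expectation (poisson_design X) (\<lambda>I. \<Sum>i\<in>tail X. of_bool (I i) *\<^sub>R c i) =
    (\<Sum>i\<in>tail X. incl_prob X i *\<^sub>R c i)"
  unfolding poisson_design_def
  by (rule expectation_sum_bernoulli[OF finite_tail incl_prob_range])

lemma expectation_centred:
  fixes c :: "nat \<Rightarrow> 'b::euclidean_space"
  shows "measure_pmf.expectation (poisson_design X)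
    (\<lambda>I. \<Sum>i\<in>tail X. (of_bool (I i) - incl_prob X i) *\<^sub>R c i) = 0"
proof -
  have "(\<lambda>I. \<Sum>i\<in>tail X. (of_bool (I i) - incl_prob X i) *\<^sub>R c i) =
      (\<lambda>I. (\<Sum>i\<in>tail X. of_bool (I i) *\<^sub>R c i) - (\<Sum>i\<in>tail X. incl_prob X i *\<^sub>R c i))"
    by (simp add: fun_eq_iff scaleR_diff_left sum_subtractf)
  then show ?thesis
    using Bochner_Integration.integral_diff[OF integrable_design integrable_design,
        of "\<lambda>I. \<Sum>i\<in>tail X. of_bool (I i) *\<^sub>R c i" "\<lambda>_. \<Sum>i\<in>tail X. incl_prob X i *\<^sub>R c i"]
    unfolding expectation_sum_design by simp
qed

lemma expectation_lin_error: "measure_pmf.expectation (poisson_design X) (lin_error X) = 0"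
  using expectation_centred[of "\<lambda>i. rel_weight i *\<^sub>R centred_val i"]
  unfolding lin_error_centred[symmetric] .

lemma expectation_norm_ratio_minus_1:
  "measure_pmf.expectation (poisson_design X) (\<lambda>I. norm_ratio I - 1) = 0"
  unfolding norm_ratio_minus_1 by (rule expectation_centred)

lemma vec_variance_lin_error:
  "vec_variance (poisson_design X) (lin_error X) =
    measure_pmf.expectation (poisson_design X) (\<lambda>I. (norm (lin_error X I))\<^sup>2)"
  by (simp add: vec_variance_def expectation_lin_error)

lemma expectation_norm_lin_error_sq:
  "measure_pmf.expectation (poisson_design X) (\<lambda>I. (norm (lin_error X I))\<^sup>2) =
    (\<Sum>i\<in>tail X. incl_prob X i * (1 - incl_prob X i) * ((rel_weight i)\<^sup>2 * (norm (centred_val i))\<^sup>2))"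
  unfolding power2_norm_eq_inner lin_error_centred expectation_inner_centred
  by (simp add: power2_eq_square mult_ac)

text \<open>Taking the expectation of the indicator supplies the missing factor:
  \<open>p * (1 - p) * x^2\<close> is exactly the variance contribution of a token.\<close>

lemma expectation_moment2:
  "measure_pmf.expectation (poisson_design X) moment2 =
    vec_variance (poisson_design X) (lin_error X)"
  unfolding moment2_def[abs_def] expectation_sum_design vec_variance_lin_error
    expectation_norm_lin_error_sq
  by (simp add: var_coeff_def mult_ac)

text \<open>The mean of the first factor drops out since the error has mean zero; a covariance of
  centred sums remains.\<close>

lemma expectation_centred_lin_error:
  fixes c :: "nat \<Rightarrow> real^'p"
  shows "measure_pmf.expectation (poisson_design X)
      (\<lambda>I. (\<Sum>i\<in>tail X. of_bool (I i) *\<^sub>R c i) \<bullet> lin_error X I) =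
    (\<Sum>i\<in>tail X. incl_prob X i * (1 - incl_prob X i) * (c i \<bullet> (rel_weight i *\<^sub>R centred_val i)))"
proof -
  let ?m = "\<Sum>i\<in>tail X. incl_prob X i *\<^sub>R c i"
  have "(\<Sum>i\<in>tail X. of_bool (I i) *\<^sub>R c i) \<bullet> lin_error X I =
      (\<Sum>i\<in>tail X. (of_bool (I i) - incl_prob X i) *\<^sub>R c i) \<bullet> lin_error X I + ?m \<bullet> lin_error X I" for I
    by (simp add: scaleR_diff_left sum_subtractf inner_diff_left)
  then have "measure_pmf.expectation (poisson_design X)
      (\<lambda>I. (\<Sum>i\<in>tail X. of_bool (I i) *\<^sub>R c i) \<bullet> lin_error X I) =
    measure_pmf.expectation (poisson_design X)
      (\<lambda>I. (\<Sum>i\<in>tail X. (of_bool (I i) - incl_prob X i) *\<^sub>R c i) \<bullet> lin_error X I)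
    + ?m \<bullet> measure_pmf.expectation (poisson_design X) (lin_error X)"
    by (simp add: integrable_design)
  then show ?thesis
    unfolding expectation_lin_error unfolding lin_error_centred expectation_inner_centred by simp
qed

text \<open>Same argument with r - 1 in place of e; products of reals are written as inner products
  to reuse the vector formula.\<close>

lemma expectation_centred_norm_ratio:
  fixes c :: "nat \<Rightarrow> real"
  shows "measure_pmf.expectation (poisson_design X)
      (\<lambda>I. (\<Sum>i\<in>tail X. of_bool (I i) *\<^sub>R c i) * (norm_ratio I - 1)) =
    (\<Sum>i\<in>tail X. incl_prob X i * (1 - incl_prob X i) * (c i * rel_weight i))"
proof -
  let ?m = "\<Sum>i\<in>tail X. incl_prob X i *\<^sub>R c i"
  have "(\<Sum>i\<in>tail X. of_bool (I i) *\<^sub>R c i) * (norm_ratio I - 1) =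
      (\<Sum>i\<in>tail X. (of_bool (I i) - incl_prob X i) *\<^sub>R c i) \<bullet> (norm_ratio I - 1)
      + ?m * (norm_ratio I - 1)" for I
    by (simp only: scaleR_diff_left sum_subtractf inner_real_def) (simp add: algebra_simps)
  then have "measure_pmf.expectation (poisson_design X)
      (\<lambda>I. (\<Sum>i\<in>tail X. of_bool (I i) *\<^sub>R c i) * (norm_ratio I - 1)) =
    measure_pmf.expectation (poisson_design X)
      (\<lambda>I. (\<Sum>i\<in>tail X. (of_bool (I i) - incl_prob X i) *\<^sub>R c i) \<bullet> (norm_ratio I - 1))
    + ?m * measure_pmf.expectation (poisson_design X) (\<lambda>I. norm_ratio I - 1)"
    using Bochner_Integration.integral_add[OF integrable_design integrable_design]
    by (simp add: integrable_design)
  then show ?thesis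
    unfolding expectation_norm_ratio_minus_1 unfolding norm_ratio_minus_1 expectation_inner_centred
    by simp
qed

lemma expectation_norm_ratio_minus_1_sq:
  "measure_pmf.expectation (poisson_design X) (\<lambda>I. (norm_ratio I - 1)\<^sup>2) =
    (\<Sum>i\<in>tail X. incl_prob X i * (1 - incl_prob X i) * (rel_weight i)\<^sup>2)"
  unfolding power2_eq_square norm_ratio_minus_1
  unfolding inner_real_def[symmetric] expectation_inner_centred by simp

section \<open>Collapse of the double sum\<close>

lemma joint_incl_prob_eq:
  assumes "i \<in> tail X" "j \<in> tail X"
  shows "joint_incl_prob X i j = (if i = j then incl_prob X i else incl_prob X i * incl_prob X j)"
proof -
  have "{I. i \<in> retained X I \<and> j \<in> retained X I} = {I. I i \<and> I j}"
    using assms disjoint by (auto simp: retained_def)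
  then show ?thesis
    using prob_bernoulli_component[of "tail X" i "incl_prob X"]
      prob_bernoulli_both[of "tail X" i j "incl_prob X"] assms incl_prob_range
    by (auto simp: joint_incl_prob_def poisson_design_def)
qed

text \<open>Factorization of joint probabilities annihilates the off-diagonal coefficients; on the
  diagonal \<open>(p - p^2) / p = 1 - p\<close> remains.\<close>

lemma var_est_double_sum_eq: "var_est_double_sum X I = var_est X I"
proof -
  let ?U = "retained X I \<inter> tail X"
  define z where "z i = (weight X i / total_weight_est X I) *\<^sub>R (val X i - hajek X I)" for i
  have "var_est_double_sum X I = (\<Sum>i\<in>?U. \<Sum>j\<in>?U.
      if i = j then (1 - incl_prob X i) * (norm (z i /\<^sub>R incl_prob X i))\<^sup>2 else 0)"
    unfolding var_est_double_sum_def Let_def z_def[symmetric]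
  proof (intro sum.cong refl)
    fix i j assume "i \<in> ?U" "j \<in> ?U"
    then show "(joint_incl_prob X i j - incl_prob X i * incl_prob X j) / joint_incl_prob X i j *
        ((z i /\<^sub>R incl_prob X i) \<bullet> (z j /\<^sub>R incl_prob X j)) =
      (if i = j then (1 - incl_prob X i) * (norm (z i /\<^sub>R incl_prob X i))\<^sup>2 else 0)"
      using incl_prob_pos[of i]
      by (simp add: joint_incl_prob_eq power2_norm_eq_inner diff_divide_distrib
          del: inner_scaleR_left inner_scaleR_right norm_scaleR)
  qed
  also have "\<dots> = (\<Sum>i\<in>?U. (1 - incl_prob X i) * (norm (z i /\<^sub>R incl_prob X i))\<^sup>2)"
    by simp
  also have "\<dots> = var_est X I"
    unfolding var_est_def z_def
    by (simp add: sum_distrib_left power_mult_distrib power_divide mult_ac divide_inverse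
        power_inverse)
  finally show ?thesis .
qed

end

section \<open>Bias of the variance estimator\<close>

text \<open>Scalar form of the Taylor estimate: \<open>n\<close> is the norm of e, \<open>q1\<close>
  the inner product of q_1 with e, \<open>v\<close> the value scale. The bounds are proportional to
  r, so \<open>q2 / r\<close> and \<open>q1 / r\<close> are bounded uniformly.\<close>

lemma second_order_remainder:
  fixes r q0 q1 q2 n v b :: real
  assumes r: "1 / 2 \<le> r" and q2: "0 \<le> q2" "q2 \<le> 4 * v\<^sup>2 * b * r"
    and q1: "\<bar>q1\<bar> \<le> 2 * v * b * r * n" and q0: "0 \<le> q0" "q0 \<le> b * r"
    and v: "0 \<le> v" and b: "0 \<le> b" and n: "0 \<le> n"
  shows "\<bar>q2 / r\<^sup>2 - 2 * q1 / r ^ 3 + q0 * n\<^sup>2 / r ^ 4 - (q2 - 2 * (q2 * (r - 1)) - 2 * q1)\<bar>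
    \<le> b * (30 * v\<^sup>2 * (r - 1)\<^sup>2 + 22 * n\<^sup>2)"
proof -
  have r0: "r > 0" using r by simp
  define t where "t = q2 / r"
  define s where "s = q1 / r"
  have t: "0 \<le> t" "t \<le> 4 * v\<^sup>2 * b" using q2 r0 by (auto simp: t_def field_simps)
  have s: "\<bar>s\<bar> \<le> 2 * v * b * n" using q1 r0 by (simp add: s_def abs_divide field_simps)
  have "2 + 1 / r \<le> 4" using r r0 by (simp add: field_simps)
  then have r4: "(r - 1)\<^sup>2 * (2 + 1 / r) \<le> (r - 1)\<^sup>2 * 4" by (intro mult_left_mono) auto
  then have "t * ((r - 1)\<^sup>2 * (2 + 1 / r)) \<le> (4 * v\<^sup>2 * b) * ((r - 1)\<^sup>2 * 4)"
    using r4 t b r0 by (intro mult_mono[OF t(2) r4]) auto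
  moreover have "0 \<le> t * ((r - 1)\<^sup>2 * (2 + 1 / r))" using t r0 by simp
  \<comment> \<open>Subtracting the tangent of \<open>1 / r^2\<close> at 1 leaves a double zero
    there.\<close>
  moreover have "q2 / r\<^sup>2 - q2 + 2 * (q2 * (r - 1)) = t * ((r - 1)\<^sup>2 * (2 + 1 / r))"
    using r0 by (simp add: t_def field_simps power2_eq_square)
  ultimately have A: "\<bar>q2 / r\<^sup>2 - q2 + 2 * (q2 * (r - 1))\<bar> \<le> 16 * (b * (v\<^sup>2 * (r - 1)\<^sup>2))"
    by (simp add: mult_ac)
  have "1 / r \<le> 2" using r r0 by (simp add: field_simps)
  then have inv: "1 / r \<le> 2" "1 / r\<^sup>2 \<le> 4" "1 / r ^ 3 \<le> 8"
    using power_mono[of "1 / r" 2 2] power_mono[of "1 / r" 2 3] r0 by (auto simp: power_divide)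
  have "2 * q1 - 2 * q1 / r ^ 3 = 2 * s * ((r - 1) * (1 + 1 / r + 1 / r\<^sup>2))"
    using r0 by (simp add: s_def field_simps power2_eq_square power3_eq_cube)
  then have "\<bar>2 * q1 - 2 * q1 / r ^ 3\<bar> = 2 * \<bar>s\<bar> * (\<bar>r - 1\<bar> * (1 + 1 / r + 1 / r\<^sup>2))"
    using r0 by (simp add: abs_mult)
  \<comment> \<open>The 7 is 1 + 2 + 4 from the bounds on inverse powers of r; the mixed product is
    then split by \<open>2 x y \<le> x^2 + y^2\<close>.\<close>
  also have "\<dots> \<le> 2 * (2 * v * b * n) * (\<bar>r - 1\<bar> * 7)"
    using s inv r0 v b n by (intro mult_mono) auto
  also have "\<dots> = 14 * b * (2 * (v * \<bar>r - 1\<bar>) * n)" by simp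
  also have "\<dots> \<le> 14 * b * ((v * \<bar>r - 1\<bar>)\<^sup>2 + n\<^sup>2)"
    using b sum_squares_bound by (intro mult_left_mono) auto
  finally have B: "\<bar>2 * q1 - 2 * q1 / r ^ 3\<bar> \<le> 14 * (b * (v\<^sup>2 * (r - 1)\<^sup>2)) + 14 * (b * n\<^sup>2)"
    by (simp add: power_mult_distrib algebra_simps)
  have "q0 * n\<^sup>2 / r ^ 4 \<le> b * r * n\<^sup>2 / r ^ 4"
    using q0 r0 by (intro divide_right_mono mult_right_mono) auto
  also have "\<dots> = b * n\<^sup>2 * (1 / r ^ 3)" using r0 by (simp add: field_simps eval_nat_numeral)
  also have "\<dots> \<le> b * n\<^sup>2 * 8" using inv b by (intro mult_left_mono) auto
  finally have C: "\<bar>q0 * n\<^sup>2 / r ^ 4\<bar> \<le> 8 * (b * n\<^sup>2)" using q0 r0 by simp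
  have split: "q2 / r\<^sup>2 - 2 * q1 / r ^ 3 + q0 * n\<^sup>2 / r ^ 4 - (q2 - 2 * (q2 * (r - 1)) - 2 * q1) =
      (q2 / r\<^sup>2 - q2 + 2 * (q2 * (r - 1))) + (2 * q1 - 2 * q1 / r ^ 3) + q0 * n\<^sup>2 / r ^ 4"
    by simp
  have tri: "\<bar>a + b + c\<bar> \<le> x + y + z" if "\<bar>a\<bar> \<le> x" "\<bar>b\<bar> \<le> y" "\<bar>c\<bar> \<le> z" for a b c x y z :: real
    using that by linarith
  have bound: "b * (30 * v\<^sup>2 * (r - 1)\<^sup>2 + 22 * n\<^sup>2) = 16 * (b * (v\<^sup>2 * (r - 1)\<^sup>2)) +
      (14 * (b * (v\<^sup>2 * (r - 1)\<^sup>2)) + 14 * (b * n\<^sup>2)) + 8 * (b * n\<^sup>2)"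
    by (simp add: distrib_left)
  show ?thesis unfolding split bound by (rule tri[OF A B C])
qed

locale bounded_cache = poisson_cache X for X :: "('d::finite, 'p::finite) eviction" +
  fixes B :: real
  assumes bounded: "bounded_weights X B"
begin

section \<open>Consequences of the weight bound\<close>

definition weight_bound :: real where
  "weight_bound = B / budget X"

lemma rel_weight_le: "i \<in> tail X \<Longrightarrow> rel_weight i \<le> weight_bound"
  using bounded by (simp add: bounded_weights_def rel_weight_def weight_bound_def)

text \<open>Relative weights are positive, so a single tail token forces the sign of B / m; an empty
  tail leaves it open.\<close>

lemma weight_bound_pos:
  assumes "tail X \<noteq> {}"
  shows "0 < weight_bound"
proof -
  obtain i where i: "i \<in> tail X" using assms by blast
  then have "0 < rel_weight i"
    using weight_pos[of i] incl_prob_pos[of i] total_weight_pos by (simp add: rel_weight_def)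
  then show ?thesis using rel_weight_le[OF i] by simp
qed

lemma rel_weight_power_le:
  assumes "i \<in> tail X"
  shows "(rel_weight i)\<^sup>2 \<le> weight_bound * rel_weight i"
    "(rel_weight i)\<^sup>2 * rel_weight i \<le> weight_bound\<^sup>2 * rel_weight i"
  using rel_weight_le[OF assms] rel_weight_nonneg[OF tail_in_cache[OF assms]]
  by (auto simp: power2_eq_square intro!: mult_right_mono mult_mono)

text \<open>Dropping \<open>1 - p\<close> leaves the tail share of the mean of r, at most 1. This
  makes the bounds independent of the number of tokens.\<close>

lemma sum_bernoulli_variance_le:
  assumes f: "\<And>i. i \<in> tail X \<Longrightarrow> f i \<le> c * rel_weight i" and c: "0 \<le> c"
  shows "(\<Sum>i\<in>tail X. incl_prob X i * (1 - incl_prob X i) * f i) \<le> c"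
proof -
  have "(\<Sum>i\<in>tail X. incl_prob X i * (1 - incl_prob X i) * f i) \<le>
      (\<Sum>i\<in>tail X. c * (incl_prob X i * rel_weight i))"
  proof (rule sum_mono)
    fix i assume i: "i \<in> tail X"
    note p = incl_prob_range[OF i]
    have "incl_prob X i * (1 - incl_prob X i) * f i \<le>
        incl_prob X i * (1 - incl_prob X i) * (c * rel_weight i)"
      using p f[OF i] by (intro mult_left_mono) auto
    also have "\<dots> \<le> incl_prob X i * 1 * (c * rel_weight i)"
      using p c rel_weight_nonneg[OF tail_in_cache[OF i]]
      by (intro mult_right_mono mult_left_mono) auto
    finally show "incl_prob X i * (1 - incl_prob X i) * f i \<le> c * (incl_prob X i * rel_weight i)"
      by (simp add: mult_ac)
  qed
  also have "\<dots> = c * (1 - cert_part)"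
    using mean_norm_ratio by (simp flip: sum_distrib_left add: eq_diff_eq add.commute)
  also have "\<dots> \<le> c * 1" using c cert_part_nonneg by (intro mult_left_mono) auto
  finally show ?thesis by simp
qed

text \<open>Pathwise counterpart: retained relative weights of the tail sum to at most r.\<close>

lemma sum_retained_le:
  assumes f: "\<And>i. i \<in> tail X \<Longrightarrow> f i \<le> c * rel_weight i" and c: "0 \<le> c"
  shows "(\<Sum>i\<in>tail X. of_bool (I i) * f i) \<le> c * norm_ratio I"
proof -
  have "(\<Sum>i\<in>tail X. of_bool (I i) * f i) \<le> (\<Sum>i\<in>tail X. c * (of_bool (I i) * rel_weight i))"
    using f by (intro sum_mono) (auto simp: of_bool_def)
  also have "\<dots> \<le> c * norm_ratio I"
    using c cert_part_nonneg
    by (simp add: norm_ratio_eq distrib_left flip: sum_distrib_left del: sum_of_bool_mult_eq)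
  finally show ?thesis .
qed

lemma var_coeff_le_weight_bound: "i \<in> tail X \<Longrightarrow> var_coeff i \<le> weight_bound * rel_weight i"
  using var_coeff_le[of i] rel_weight_power_le(1)[of i] by simp

lemma weighted_centred_val_le:
  assumes "i \<in> tail X" "0 \<le> c"
  shows "c * (norm (centred_val i))\<^sup>2 \<le> 4 * (value_scale X)\<^sup>2 * c"
  using mult_left_mono[OF norm_centred_val_sq_le[OF tail_in_cache[OF assms(1)]] assms(2)]
  by (simp add: mult_ac)

lemma moment0_le:
  assumes "0 \<le> weight_bound"
  shows "0 \<le> moment0 I" "moment0 I \<le> weight_bound * norm_ratio I"
proof -
  show "0 \<le> moment0 I"
    unfolding moment0_def using var_coeff_nonneg by (intro sum_nonneg) auto
  show "moment0 I \<le> weight_bound * norm_ratio I"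
    unfolding moment0_def
    using var_coeff_le_weight_bound assms by (rule sum_retained_le)
qed

lemma moment2_le:
  assumes "0 \<le> weight_bound"
  shows "0 \<le> moment2 I" "moment2 I \<le> 4 * (value_scale X)\<^sup>2 * weight_bound * norm_ratio I"
proof -
  show "0 \<le> moment2 I"
    unfolding moment2_def using var_coeff_nonneg by (intro sum_nonneg) auto
  have "var_coeff i * (norm (centred_val i))\<^sup>2 \<le>
      4 * (value_scale X)\<^sup>2 * weight_bound * rel_weight i" if i: "i \<in> tail X" for i
  proof -
    have "var_coeff i * (norm (centred_val i))\<^sup>2 \<le> 4 * (value_scale X)\<^sup>2 * var_coeff i"
      using weighted_centred_val_le[OF i var_coeff_nonneg] .
    also have "\<dots> \<le> 4 * (value_scale X)\<^sup>2 * (weight_bound * rel_weight i)"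
      using var_coeff_le_weight_bound[OF i]
      by (intro mult_left_mono) auto
    finally show ?thesis by (simp add: mult_ac)
  qed
  then show "moment2 I \<le> 4 * (value_scale X)\<^sup>2 * weight_bound * norm_ratio I"
    unfolding moment2_def real_scaleR_def using assms by (intro sum_retained_le) auto
qed

lemma norm_moment1_le:
  assumes "0 \<le> weight_bound"
  shows "norm (moment1 I) \<le> 2 * value_scale X * weight_bound * norm_ratio I"
proof -
  have "norm (moment1 I) \<le>
      (\<Sum>i\<in>tail X. of_bool (I i) * (var_coeff i * norm (centred_val i)))"
    unfolding moment1_def using var_coeff_nonneg
    by (intro sum_norm_le) (auto simp: of_bool_def)
  also have "\<dots> \<le> 2 * value_scale X * weight_bound * norm_ratio I"
  proof (rule sum_retained_le)
    fix i assume i: "i \<in> tail X"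
    have "var_coeff i * norm (centred_val i) \<le>
        (weight_bound * rel_weight i) * (2 * value_scale X)"
      using var_coeff_le_weight_bound[OF i] var_coeff_nonneg[of i]
        norm_centred_val_le[OF tail_in_cache[OF i]] rel_weight_nonneg[OF tail_in_cache[OF i]] assms
      by (intro mult_mono) auto
    then show "var_coeff i * norm (centred_val i) \<le> 2 * value_scale X * weight_bound * rel_weight i"
      by (simp add: mult_ac)
  qed (use assms value_scale_nonneg in auto)
  finally show ?thesis .
qed

lemma expectation_norm_ratio_sq_le:
  assumes "0 \<le> weight_bound"
  shows "measure_pmf.expectation (poisson_design X) (\<lambda>I. (norm_ratio I - 1)\<^sup>2) \<le> weight_bound"
  unfolding expectation_norm_ratio_minus_1_sq
  using rel_weight_power_le(1) assms by (rule sum_bernoulli_variance_le)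

lemma vec_variance_lin_error_le:
  assumes "0 \<le> weight_bound"
  shows "vec_variance (poisson_design X) (lin_error X) \<le> 4 * (value_scale X)\<^sup>2 * weight_bound"
  unfolding vec_variance_lin_error expectation_norm_lin_error_sq
proof (rule sum_bernoulli_variance_le)
  fix i assume i: "i \<in> tail X"
  have "(rel_weight i)\<^sup>2 * (norm (centred_val i))\<^sup>2 \<le> 4 * (value_scale X)\<^sup>2 * (rel_weight i)\<^sup>2"
    using i by (rule weighted_centred_val_le) simp
  also have "\<dots> \<le> 4 * (value_scale X)\<^sup>2 * (weight_bound * rel_weight i)"
    using rel_weight_power_le(1)[OF i] by (intro mult_left_mono) auto
  finally show "(rel_weight i)\<^sup>2 * (norm (centred_val i))\<^sup>2 \<le>
      4 * (value_scale X)\<^sup>2 * weight_bound * rel_weight i" by (simp add: mult_ac)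
qed (use assms in auto)

lemma vec_variance_lin_error_nonneg: "0 \<le> vec_variance (poisson_design X) (lin_error X)"
  by (simp add: vec_variance_lin_error)

text \<open>The common value of the covariances of q_2 with r and of q_1 with e: in both, a token
  contributes its q_2 coefficient times x_i.\<close>

definition third_order :: real where
  "third_order = (\<Sum>i\<in>tail X. incl_prob X i * (1 - incl_prob X i) *
     (var_coeff i * (norm (centred_val i))\<^sup>2 * rel_weight i))"

lemma third_order_nonneg: "0 \<le> third_order"
  unfolding third_order_def
  using incl_prob_range var_coeff_nonneg rel_weight_nonneg tail_in_cache
  by (intro sum_nonneg mult_nonneg_nonneg) auto

text \<open>There are three factors x_i: two are bounded by b, and the third is summed against the
  inclusion probabilities.\<close>

lemma third_order_le: "third_order \<le> 4 * (value_scale X)\<^sup>2 * weight_bound\<^sup>2"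
  unfolding third_order_def
proof (rule sum_bernoulli_variance_le)
  fix i assume i: "i \<in> tail X"
  note x = rel_weight_nonneg[OF tail_in_cache[OF i]]
  have "var_coeff i * (norm (centred_val i))\<^sup>2 * rel_weight i \<le>
      4 * (value_scale X)\<^sup>2 * var_coeff i * rel_weight i"
    using weighted_centred_val_le[OF i var_coeff_nonneg] x by (intro mult_right_mono) auto
  also have "\<dots> \<le> 4 * (value_scale X)\<^sup>2 * ((rel_weight i)\<^sup>2 * rel_weight i)"
    using mult_right_mono[OF var_coeff_le[OF i] x] by (simp add: mult.assoc mult_left_mono)
  also have "\<dots> \<le> 4 * (value_scale X)\<^sup>2 * (weight_bound\<^sup>2 * rel_weight i)"
    using rel_weight_power_le(2)[OF i] by (intro mult_left_mono) auto
  finally show "var_coeff i * (norm (centred_val i))\<^sup>2 * rel_weight i \<le>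
      4 * (value_scale X)\<^sup>2 * weight_bound\<^sup>2 * rel_weight i" by (simp add: mult_ac)
qed simp

lemma expectation_moment2_norm_ratio:
  "measure_pmf.expectation (poisson_design X) (\<lambda>I. moment2 I * (norm_ratio I - 1)) = third_order"
  unfolding moment2_def expectation_centred_norm_ratio third_order_def ..

lemma expectation_moment1_lin_error:
  "measure_pmf.expectation (poisson_design X) (\<lambda>I. moment1 I \<bullet> lin_error X I) = third_order"
  unfolding moment1_def expectation_centred_lin_error third_order_def
  by (simp add: power2_norm_eq_inner mult_ac)

text \<open>Chernoff bound with the certainty part as its constant, then the exponential is traded
  for a quadratic.\<close>

lemma prob_norm_ratio_less_half:
  assumes "0 < weight_bound"
  shows "measure_pmf.expectation (poisson_design X) (\<lambda>I. of_bool (norm_ratio I < 1 / 2))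
    \<le> 128 * weight_bound\<^sup>2"
  unfolding expectation_of_bool norm_ratio_eq poisson_design_def
  using incl_prob_range rel_weight_nonneg[OF tail_in_cache] rel_weight_le assms
    cert_part_nonneg mean_norm_ratio
  by (intro order_trans[OF prob_weighted_sum_less_half exp_minus_inverse_le]) auto

section \<open>First-order expansion, remainder and bias\<close>

definition leading :: "(nat \<Rightarrow> bool) \<Rightarrow> real" where
  "leading I = moment2 I - 2 * (moment2 I * (norm_ratio I - 1)) - 2 * (moment1 I \<bullet> lin_error X I)"

text \<open>Both correction terms contribute the same covariance with factor -2, hence the
  4.\<close>

lemma expectation_leading:
  "measure_pmf.expectation (poisson_design X) leading =
    vec_variance (poisson_design X) (lin_error X) - 4 * third_order"
  unfolding leading_def[abs_def]
  by (simp add: integrable_design expectation_moment2_norm_ratio expectation_moment1_lin_error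
      expectation_moment2)

lemma moment1_inner_le:
  assumes "0 \<le> weight_bound"
  shows "\<bar>moment1 I \<bullet> lin_error X I\<bar> \<le>
    2 * value_scale X * weight_bound * norm_ratio I * norm (lin_error X I)"
  using order_trans[OF Cauchy_Schwarz_ineq2 mult_right_mono[OF norm_moment1_le[OF assms]]] by simp

lemma remainder_le:
  assumes b: "0 < weight_bound" "weight_bound \<le> 1"
  shows "\<bar>var_est X I - leading I\<bar> \<le>
    weight_bound * (30 * (value_scale X)\<^sup>2 * (norm_ratio I - 1)\<^sup>2 + 22 * (norm (lin_error X I))\<^sup>2)
    + 12 * (value_scale X)\<^sup>2 * of_bool (norm_ratio I < 1 / 2)"
proof (cases "norm_ratio I < 1 / 2")
  case False
  let ?r = "norm_ratio I"
  have b0: "0 \<le> weight_bound" using b by simp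
  have r: "1 / 2 \<le> ?r" "?r \<noteq> 0" using False by auto
  show ?thesis
    unfolding var_est_moments[OF r(2)] leading_def
    using second_order_remainder[OF r(1) moment2_le[OF b0] moment1_inner_le[OF b0]
        moment0_le[OF b0] value_scale_nonneg b0 norm_ge_zero] False by simp
next
  case True
  let ?v = "value_scale X" and ?r = "norm_ratio I"
  have b0: "0 \<le> weight_bound" using b by simp
  have r0: "0 \<le> ?r" by (rule norm_ratio_nonneg)
  \<comment> \<open>No expansion is valid for small r; here every term is bounded by a multiple of
    the squared value scale.\<close>
  have "weight_bound * ?r \<le> 1 * (1 / 2)" using b True r0 by (intro mult_mono) auto
  then have br: "weight_bound * ?r \<le> 1 / 2" by simp
  have m2: "moment2 I \<le> 2 * ?v\<^sup>2"
  proof -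
    have "moment2 I \<le> 4 * ?v\<^sup>2 * (weight_bound * ?r)"
      using moment2_le(2)[OF b0, of I] by (simp only: mult.assoc)
    also have "4 * ?v\<^sup>2 * (weight_bound * ?r) \<le> 4 * ?v\<^sup>2 * (1 / 2)"
      using br by (intro mult_left_mono) auto
    finally show ?thesis by simp
  qed
  have "moment2 I - 2 * (moment2 I * (?r - 1)) = moment2 I * (3 - 2 * ?r)"
    by (simp add: algebra_simps)
  then have "\<bar>moment2 I - 2 * (moment2 I * (?r - 1))\<bar> = moment2 I * (3 - 2 * ?r)"
    using moment2_le(1)[OF b0] True by simp
  also have "\<dots> \<le> 2 * ?v\<^sup>2 * 3"
    using m2 moment2_le(1)[OF b0] r0 True by (intro mult_mono) auto
  finally have A: "\<bar>moment2 I - 2 * (moment2 I * (?r - 1))\<bar> \<le> 6 * ?v\<^sup>2" by simp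
  have "\<bar>moment1 I \<bullet> lin_error X I\<bar> \<le> 2 * ?v * weight_bound * ?r * norm (lin_error X I)"
    by (rule moment1_inner_le[OF b0])
  also have "\<dots> = 2 * ?v * (weight_bound * ?r) * norm (lin_error X I)" by simp
  also have "\<dots> \<le> 2 * ?v * (1 / 2) * (2 * ?v * (1 / 2))"
  proof (intro mult_mono)
    have "2 * ?v * ?r \<le> 2 * ?v * (1 / 2)"
      using True value_scale_nonneg by (intro mult_left_mono) auto
    then show "norm (lin_error X I) \<le> 2 * ?v * (1 / 2)" using norm_lin_error_le[of I] by simp
  qed (use br b0 r0 value_scale_nonneg in auto)
  finally have B: "\<bar>moment1 I \<bullet> lin_error X I\<bar> \<le> ?v\<^sup>2" by (simp add: power2_eq_square)
  \<comment> \<open>12 = 4 + 6 + 2: the estimator, the q_2 terms, and twice the inner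
    product.\<close>
  have "\<bar>var_est X I - leading I\<bar> \<le> 12 * ?v\<^sup>2"
    using A B var_est_nonneg[of I] var_est_le[of I] unfolding leading_def by linarith
  then show ?thesis using True b0 by (simp add: add_nonneg_nonneg add_increasing)
qed

lemma var_est_bias:
  "\<bar>measure_pmf.expectation (poisson_design X) (var_est X)
      - vec_variance (poisson_design X) (lin_error X)\<bar>
    \<le> 2000 * (value_scale X)\<^sup>2 * (B\<^sup>2 / (budget X)\<^sup>2)"
proof -
  let ?E = "measure_pmf.expectation (poisson_design X)" and ?v = "value_scale X"
  let ?b = weight_bound
  have bb: "B\<^sup>2 / (budget X)\<^sup>2 = ?b\<^sup>2" by (simp add: weight_bound_def power_divide)
  \<comment> \<open>With an empty tail both quantities vanish, whatever the sign of b. For b > 1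
    crude bounds suffice, as 1 and b are below \<open>b^2\<close>.\<close>
  consider "tail X = {}" | "0 < ?b" "1 < ?b" | "0 < ?b" "?b \<le> 1"
    using weight_bound_pos by fastforce
  then show ?thesis
  proof cases
    case 1
    have "var_est X = (\<lambda>_. 0)" by (simp add: fun_eq_iff var_est_rel_weight 1)
    moreover have "vec_variance (poisson_design X) (lin_error X) = 0"
      by (simp add: vec_variance_lin_error expectation_norm_lin_error_sq 1)
    ultimately show ?thesis by simp
  next
    case 2
    have "0 \<le> ?E (var_est X)" by (simp add: var_est_nonneg)
    moreover have "?E (var_est X) \<le> ?E (\<lambda>_. 4 * ?v\<^sup>2)"
      by (intro integral_mono integrable_design var_est_le)
    moreover have "4 * ?v\<^sup>2 * 1 \<le> 4 * ?v\<^sup>2 * ?b\<^sup>2"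
      using 2 by (intro mult_left_mono) auto
    moreover have "4 * ?v\<^sup>2 * ?b \<le> 4 * ?v\<^sup>2 * ?b\<^sup>2"
      using 2 by (intro mult_left_mono) (auto simp: power2_eq_square)
    moreover have "0 \<le> 1996 * ?v\<^sup>2 * ?b\<^sup>2" by simp
    ultimately show ?thesis
      using vec_variance_lin_error_nonneg vec_variance_lin_error_le 2 unfolding bb
      by (simp add: abs_le_iff)
  next
    case 3
    have b0: "0 \<le> ?b" using 3 by simp
    have "\<bar>?E (\<lambda>I. var_est X I - leading I)\<bar> \<le> ?E (\<lambda>I. \<bar>var_est X I - leading I\<bar>)"
      by (rule integral_abs_bound)
    also have "\<dots> \<le> ?E (\<lambda>I. ?b * (30 * ?v\<^sup>2 * (norm_ratio I - 1)\<^sup>2 + 22 * (norm (lin_error X I))\<^sup>2)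
        + 12 * ?v\<^sup>2 * of_bool (norm_ratio I < 1 / 2))"
      using remainder_le[OF 3] by (intro integral_mono integrable_design)
    also have "\<dots> = ?b * (30 * ?v\<^sup>2 * ?E (\<lambda>I. (norm_ratio I - 1)\<^sup>2)
        + 22 * vec_variance (poisson_design X) (lin_error X))
        + 12 * ?v\<^sup>2 * ?E (\<lambda>I. of_bool (norm_ratio I < 1 / 2))"
      by (simp add: integrable_design vec_variance_lin_error)
    also have "\<dots> \<le> ?b * (30 * ?v\<^sup>2 * ?b + 22 * (4 * ?v\<^sup>2 * ?b)) + 12 * ?v\<^sup>2 * (128 * ?b\<^sup>2)"
      using b0 expectation_norm_ratio_sq_le[OF b0] vec_variance_lin_error_le[OF b0]
        prob_norm_ratio_less_half[OF 3(1)]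
      by (intro add_mono mult_left_mono) auto
    \<comment> \<open>1654 = 30 + 22 * 4 + 12 * 128. The shift by \<open>4 * third_order\<close>
      adds at most 16, so 2000 leaves room.\<close>
    also have "\<dots> = 1654 * (?v\<^sup>2 * ?b\<^sup>2)" by (simp add: power2_eq_square)
    finally have "\<bar>?E (var_est X) - (vec_variance (poisson_design X) (lin_error X) - 4 * third_order)\<bar>
        \<le> 1654 * (?v\<^sup>2 * ?b\<^sup>2)"
      by (simp add: integrable_design expectation_leading)
    moreover have "0 \<le> ?v\<^sup>2 * ?b\<^sup>2" by simp
    ultimately have "\<bar>?E (var_est X) - vec_variance (poisson_design X) (lin_error X)\<bar>
        \<le> 2000 * (?v\<^sup>2 * ?b\<^sup>2)"
      using third_order_nonneg third_order_le by linarith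
    then show ?thesis by (simp add: bb mult.assoc)
  qed
qed

end

section \<open>Bias order, computability, collapse of the double sum and linear cost\<close>

theorem theorem2:
  shows
    "(\<exists>K::real. \<forall>(X :: ('d::finite, 'p::finite) eviction) (B::real).
        poisson_eviction X \<and> known_design X \<and> bounded_weights X B \<longrightarrow>
        \<bar>measure_pmf.expectation (poisson_design X) (var_est X)
          - vec_variance (poisson_design X) (lin_error X)\<bar>
        \<le> K * (value_scale X)\<^sup>2 * (B\<^sup>2 / (budget X)\<^sup>2))
   \<and> (\<exists>P :: nat set \<Rightarrow> nat set \<Rightarrow> ('d, 'p) datum program.
        (\<forall>A S. inputs (P A S) \<subseteq> stored_data S) \<and>
        (\<forall>(X :: ('d, 'p) eviction) I. poisson_eviction X \<and> known_design X \<longrightarrow>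
           run (read_datum X I) (P (cert X) (retained X I)) = var_est X I))
   \<and> (\<forall>(X :: ('d, 'p) eviction) I. poisson_eviction X \<and> known_design X \<longrightarrow>
        var_est_double_sum X I = var_est X I)
   \<and> (\<exists>(Q :: nat set \<Rightarrow> ('d, 'p) datum program) (c::nat).
        (\<forall>U. inputs (Q U) \<subseteq> stored_data U \<union> step_output) \<and>
        (\<forall>U. finite U \<longrightarrow> ops (Q U) \<le> c * card U) \<and>
        (\<forall>(X :: ('d, 'p) eviction) I. poisson_eviction X \<and> known_design X \<longrightarrow>
           run (read_datum X I) (Q (retained X I \<inter> tail X)) = var_est X I))"
proof (intro conjI)
  show "\<exists>K::real. \<forall>(X :: ('d, 'p) eviction) (B::real).
      poisson_eviction X \<and> known_design X \<and> bounded_weights X B \<longrightarrow>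
      \<bar>measure_pmf.expectation (poisson_design X) (var_est X)
        - vec_variance (poisson_design X) (lin_error X)\<bar>
      \<le> K * (value_scale X)\<^sup>2 * (B\<^sup>2 / (budget X)\<^sup>2)"
    by (intro exI[of _ 2000] allI impI bounded_cache.var_est_bias)
      (auto simp: bounded_cache_def poisson_cache_def bounded_cache_axioms_def)
  show "\<forall>(X :: ('d, 'p) eviction) I. poisson_eviction X \<and> known_design X \<longrightarrow>
      var_est_double_sum X I = var_est X I"
    using poisson_cache.var_est_double_sum_eq by (auto simp: poisson_cache_def)
  \<comment> \<open>The guard is needed as the claim on inputs ranges over all sets, and the
    programs for normalizer and output sum over \<open>S\<close>.\<close>
  let ?P = "\<lambda>A S. if finite S then var_prog (norm_prog S) (out_prog S) (S - A)
    else Const 0 :: ('d, 'p) datum program"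
  have "inputs (?P A S) \<subseteq> stored_data S" for A S
  proof (cases "finite S")
    case True
    have "inputs (var_prog (norm_prog S) (out_prog S) (S - A)) \<subseteq> stored_data S"
      using True
      by (intro inputs_var_prog inputs_norm_prog inputs_out_prog) (auto simp: stored_data_def)
    then show ?thesis using True by simp
  qed simp
  moreover have "run (read_datum X I) (?P (cert X) (retained X I)) = var_est X I"
    if "poisson_eviction X \<and> known_design X" for X :: "('d, 'p) eviction" and I
  proof -
    interpret poisson_cache X using that by unfold_locales auto
    show ?thesis
      by (simp add: retained_diff_cert run_var_prog run_norm_prog run_out_prog)
  qed
  ultimately show "\<exists>P :: nat set \<Rightarrow> nat set \<Rightarrow> ('d, 'p) datum program.
      (\<forall>A S. inputs (P A S) \<subseteq> stored_data S) \<and>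
      (\<forall>(X :: ('d, 'p) eviction) I. poisson_eviction X \<and> known_design X \<longrightarrow>
         run (read_datum X I) (P (cert X) (retained X I)) = var_est X I)"
    by (intro exI[of _ ?P]) blast
  \<comment> \<open>Reading normalizer and output at no cost keeps each summand at a cost
    independent of the retained set; recomputing them inside every summand would not.\<close>
  let ?n = "Input NormHat :: ('d, 'p) datum program" and ?h = "\<lambda>c. Input (OutHat c)"
  have "inputs (var_prog ?n ?h U) \<subseteq> stored_data U \<union> step_output" for U
    by (rule inputs_var_prog) (auto simp: step_output_def)
  moreover have "run (read_datum X I) (var_prog ?n ?h (retained X I \<inter> tail X)) = var_est X I"
    if "poisson_eviction X \<and> known_design X" for X :: "('d, 'p) eviction" and I
  proof -
    interpret poisson_cache X using that by unfold_locales auto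
    show ?thesis by (simp add: run_var_prog)
  qed
  ultimately show "\<exists>(Q :: nat set \<Rightarrow> ('d, 'p) datum program) (c::nat).
      (\<forall>U. inputs (Q U) \<subseteq> stored_data U \<union> step_output) \<and>
      (\<forall>U. finite U \<longrightarrow> ops (Q U) \<le> c * card U) \<and>
      (\<forall>(X :: ('d, 'p) eviction) I. poisson_eviction X \<and> known_design X \<longrightarrow>
         run (read_datum X I) (Q (retained X I \<inter> tail X)) = var_est X I)"
    by (intro exI[of _ "var_prog ?n ?h"] exI[of _ "Suc (ops (var_term_prog ?n ?h 0))"])
      (simp add: ops_var_prog)
qed

end
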